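(* Let $I\subset S$ be a nonzero proper graded ideal and let $\mathfrak{p}\in\operatorname{Ass}^\infty(I)$. Then: (a) for all $k\ge1$ with $\mathfrak{p}\in\operatorname{Ass}(I^k)$, $\alpha((I^k:\mathfrak{p})/I^k)\le \mathrm{v}_\mathfrak{p}(I^k)\le \omega((I^k:\mathfrak{p})/I^k)$; (b) the functions $k\mapsto\alpha((I^k:\mathfrak{p})/I^k)$ and $k\mapsto\omega((I^k:\mathfrak{p})/I^k)$ are linear functions of $k$ (with integer coefficients) for $k\gg0$; (c) there exist functions $f(k),g(k)$ which are linear in $k$ for $k\gg0$ such that $f(k)\le \mathrm{v}(I^k)\le g(k)$ for all $k\gg0$.
   Context: $S=K[x_1,\dots,x_n]$ is a standard graded polynomial ring over a field $K$, $S_d$ its degree-$d$ component, $\mathfrak{m}=(x_1,\dots,x_n)$. For a graded ideal $I\subset S$ and $\mathfrak{p}\in\operatorname{Ass}(I)$, $\mathrm{v}_\mathfrak{p}(I)=\min\{d:\exists f\in S_d \text{ with } (I:f)=\mathfrak{p}\}$ and $\mathrm{v}(I)=\min\{d:\exists f\in S_d\text{ with }(I:f)\in\operatorname{Ass}(I)\}$. $\operatorname{Ass}^\infty(I)$ is the set of primes lying in $\operatorname{Ass}(I^k)$ for all $k\gg0$ (stable primes; $\operatorname{Ass}(I^k)$ is eventually constant by Brodmann). For a nonzero finitely generated graded $S$-module $M$, $\alpha(M)=\min\{d:M_d\ne0\}$ and $\omega(M)=\max\{d:(M/\mathfrak{m}M)_d\neq0\}$ (the largest degree of a minimal homogeneous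 generator). *)

theory Defs
  imports Main "HOL-Library.Poly_Mapping"
begin

text \<open>The polynomial ring S = K[x_1,...,x_n]: polynomials in variables indexed by
  a finite type 'n (so n = CARD('n)) with coefficients in a field 'k.
  A monomial is a finitely supported exponent vector.\<close>

type_synonym ('n, 'k) mpoly = "('n \<Rightarrow>\<^sub>0 nat) \<Rightarrow>\<^sub>0 'k"

definition mdeg :: "('n \<Rightarrow>\<^sub>0 nat) \<Rightarrow> nat" where
  "mdeg m = (\<Sum>i\<in>Poly_Mapping.keys m. Poly_Mapping.lookup m i)"

definition var :: "'n \<Rightarrow> ('n, 'k::field) mpoly" where
  "var i = Poly_Mapping.single (Poly_Mapping.single i 1) 1"

text \<open>f lies in S_d (homogeneous of degree d; 0 lies in every S_d).\<close>
definition homog :: "nat \<Rightarrow> ('n, 'k::field) mpoly \<Rightarrow> bool" where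
  "homog d f \<longleftrightarrow> (\<forall>m\<in>Poly_Mapping.keys f. mdeg m = d)"

definition hcomp :: "nat \<Rightarrow> ('n, 'k::field) mpoly \<Rightarrow> ('n, 'k) mpoly" where
  "hcomp d f = Poly_Mapping.mapp (\<lambda>m c. if mdeg m = d then c else 0) f"

definition is_ideal :: "'a::comm_ring_1 set \<Rightarrow> bool" where
  "is_ideal I \<longleftrightarrow> 0 \<in> I \<and> (\<forall>a\<in>I. \<forall>b\<in>I. a + b \<in> I) \<and> (\<forall>a\<in>I. \<forall>r. r * a \<in> I)"

definition ideal_gen :: "'a::comm_ring_1 set \<Rightarrow> 'a set" where
  "ideal_gen A = \<Inter>{J. is_ideal J \<and> A \<subseteq> J}"

definition ideal_sum :: "'a::comm_ring_1 set \<Rightarrow> 'a set \<Rightarrow> 'a set" where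
  "ideal_sum I J = {a + b | a b. a \<in> I \<and> b \<in> J}"

definition ideal_prod :: "'a::comm_ring_1 set \<Rightarrow> 'a set \<Rightarrow> 'a set" where
  "ideal_prod I J = ideal_gen {a * b | a b. a \<in> I \<and> b \<in> J}"

primrec ideal_pow :: "'a::comm_ring_1 set \<Rightarrow> nat \<Rightarrow> 'a set" where
  "ideal_pow I 0 = UNIV"
| "ideal_pow I (Suc k) = ideal_prod I (ideal_pow I k)"

definition colon :: "'a::comm_ring_1 set \<Rightarrow> 'a set \<Rightarrow> 'a set" where
  "colon I J = {g. \<forall>h\<in>J. g * h \<in> I}"

definition colon_elem :: "'a::comm_ring_1 set \<Rightarrow> 'a \<Rightarrow> 'a set" where
  "colon_elem I f = {g. g * f \<in> I}"

definition prime_ideal :: "'a::comm_ring_1 set \<Rightarrow> bool" where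
  "prime_ideal P \<longleftrightarrow> is_ideal P \<and> P \<noteq> UNIV \<and> (\<forall>a b. a * b \<in> P \<longrightarrow> a \<in> P \<or> b \<in> P)"

definition graded_ideal :: "('n, 'k::field) mpoly set \<Rightarrow> bool" where
  "graded_ideal I \<longleftrightarrow> is_ideal I \<and> (\<forall>f\<in>I. \<forall>d. hcomp d f \<in> I)"

definition max_ideal :: "('n, 'k::field) mpoly set" where
  "max_ideal = ideal_gen (range var)"

definition Ass :: "'a::comm_ring_1 set \<Rightarrow> 'a set set" where
  "Ass I = {P. prime_ideal P \<and> (\<exists>f. colon_elem I f = P)}"

definition Ass_inf :: "'a::comm_ring_1 set \<Rightarrow> 'a set set" where
  "Ass_inf I = {P. \<exists>k0. \<forall>k\<ge>k0. P \<in> Ass (ideal_pow I k)}"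

definition v_number_at :: "('n, 'k::field) mpoly set \<Rightarrow> ('n, 'k) mpoly set \<Rightarrow> nat" where
  "v_number_at I P = (LEAST d. \<exists>f. homog d f \<and> colon_elem I f = P)"

definition v_number :: "('n, 'k::field) mpoly set \<Rightarrow> nat" where
  "v_number I = (LEAST d. \<exists>f. homog d f \<and> colon_elem I f \<in> Ass I)"

text \<open>For graded ideals N \<subseteq> J, the graded module M = J/N has
  M_d = J_d / N_d, and M/mM = J/(N + mJ). Hence
  alpha(M) = min d with some f in J_d not in N, and
  omega(M) = max d with some f in J_d not in N + mJ.\<close>
definition alpha_quot :: "('n, 'k::field) mpoly set \<Rightarrow> ('n, 'k) mpoly set \<Rightarrow> nat" where
  "alpha_quot J N = (LEAST d. \<exists>f. homog d f \<and> f \<in> J \<and> f \<notin> N)"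

definition omega_quot :: "('n, 'k::field) mpoly set \<Rightarrow> ('n, 'k) mpoly set \<Rightarrow> nat" where
  "omega_quot J N =
     (GREATEST d. \<exists>f. homog d f \<and> f \<in> J \<and> f \<notin> ideal_sum N (ideal_prod max_ideal J))"

end

theory Submission
  imports Defs "HOL-Library.Infinite_Set" "HOL-Library.Product_Lexorder" "HOL.Modules"
begin

text \<open>By Artin--Rees, \<open>(I\<^sup>k : P) \<subseteq> I\<^sup>k\<^sup>-\<^sup>c\<close> for large \<open>k\<close>, because \<open>I \<subseteq> P\<close>
  contains a non-zero-divisor; as the Rees algebra is Noetherian, it follows that
  \<open>(I\<^sup>k\<^sup>+\<^sup>1 : P) = I (I\<^sup>k : P)\<close> for large \<open>k\<close>. Hence the minimal generators of
  \<open>(I\<^sup>k : P) / I\<^sup>k\<close> come from products \<open>f\<^sup>u e\<^sub>j\<close> of generators \<open>f\<^sub>i\<close> of \<open>I\<close> with generators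
  \<open>e\<^sub>j\<close> of one fixed \<open>(I\<^sup>K : P)\<close>, and their degrees are those of the standard ones among these
  products, i.e. those which are not combinations of smaller ones. The standard exponents \<open>u\<close> form a
  down-closed set, which by Dickson's lemma is a finite union of boxes (some exponents fixed, the
  others free); on a box the extreme values of a linear weight over \<open>|u| = k\<close> are linear in \<open>k\<close>.
  The same standard monomials prove the Noetherian statements. For the bounds on the v-number, write
  a homogeneous witness of \<open>P\<close> in minimal generators of \<open>(N : P) / N\<close>: since \<open>P\<close> is prime, one of
  them is a witness too. The lower bound in (c) is then taken to be zero.\<close>

section \<open>Ideals\<close>

text \<open>The quotient of \<open>Q k = (I^k : P)\<close> by \<open>H k = I^k + m * Q k\<close>
  (indices up to a shift) is killed by the variables, so finding degrees of minimal generators is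
  K-linear algebra: only scalar combinations of products matter. This is why one locale about
  K-subspaces serves twice. For the Noetherian results the variables are multipliers of weight 0
  beside the generators of \<open>I\<close> in weight 1; for the degrees only the generators of
  \<open>I\<close> multiply, because variables land in \<open>H k\<close>. The products may be
  linearly dependent, and so standardness is defined by congruences between products, not by leading
  monomials of polynomials. The inclusion in \<open>I^(k-c)\<close> places the re-indexed colon
  ideals inside the Rees algebra, where finite generation is available. Alpha is covered by the same
  degree sets: by graded Nakayama the least degree of a nonzero class is that of a minimal
  generator, and a minimum is a maximum up to sign.\<close>

lemma is_idealD:
  assumes "is_ideal I"
  shows "0 \<in> I" "a \<in> I \<Longrightarrow> b \<in> I \<Longrightarrow> a + b \<in> I" "a \<in> I \<Longrightarrow> r * a \<in> I" "a \<in> I \<Longrightarrow> a * r \<in> I"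
    "a \<in> I \<Longrightarrow> - a \<in> I" "a \<in> I \<Longrightarrow> b \<in> I \<Longrightarrow> a - b \<in> I"
proof -
  show "0 \<in> I" and add: "\<And>a b. a \<in> I \<Longrightarrow> b \<in> I \<Longrightarrow> a + b \<in> I"
    and mult: "\<And>a r. a \<in> I \<Longrightarrow> r * a \<in> I"
    using assms by (auto simp: is_ideal_def)
  show "a \<in> I \<Longrightarrow> a * r \<in> I"
    using mult[of a r] by (simp add: mult.commute)
  show neg: "\<And>a. a \<in> I \<Longrightarrow> - a \<in> I"
    using mult[of _ "- 1"] by simp
  show "a \<in> I \<Longrightarrow> b \<in> I \<Longrightarrow> a - b \<in> I"
    using add[of a "- b"] neg[of b] by simp
qed

lemma is_ideal_sum: "is_ideal I \<Longrightarrow> (\<And>x. x \<in> A \<Longrightarrow> f x \<in> I) \<Longrightarrow> sum f A \<in> I"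
  by (induction A rule: infinite_finite_induct) (auto intro: is_idealD)

lemma is_ideal_UNIV: "is_ideal UNIV"
  by (simp add: is_ideal_def)

lemma is_ideal_ideal_gen: "is_ideal (ideal_gen A)"
  by (auto simp: ideal_gen_def is_ideal_def)

lemma ideal_gen_superset: "A \<subseteq> ideal_gen A"
  by (auto simp: ideal_gen_def)

lemma ideal_gen_least: "is_ideal J \<Longrightarrow> A \<subseteq> J \<Longrightarrow> ideal_gen A \<subseteq> J"
  by (auto simp: ideal_gen_def)

lemma ideal_gen_mono: "A \<subseteq> B \<Longrightarrow> ideal_gen A \<subseteq> ideal_gen B"
  by (meson ideal_gen_least ideal_gen_superset is_ideal_ideal_gen subset_trans)

lemma is_ideal_ideal_prod: "is_ideal (ideal_prod I J)"
  by (simp add: ideal_prod_def is_ideal_ideal_gen)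

lemma ideal_prodI: "a \<in> I \<Longrightarrow> b \<in> J \<Longrightarrow> a * b \<in> ideal_prod I J"
  unfolding ideal_prod_def by (rule subsetD[OF ideal_gen_superset]) blast

lemma ideal_prod_least:
  "is_ideal L \<Longrightarrow> (\<And>a b. a \<in> I \<Longrightarrow> b \<in> J \<Longrightarrow> a * b \<in> L) \<Longrightarrow> ideal_prod I J \<subseteq> L"
  unfolding ideal_prod_def by (rule ideal_gen_least) auto

lemma ideal_prod_subset: "is_ideal J \<Longrightarrow> ideal_prod I J \<subseteq> J"
  by (rule ideal_prod_least) (auto intro: is_idealD)

lemma is_ideal_ideal_sum:
  assumes "is_ideal I" "is_ideal J"
  shows "is_ideal (ideal_sum I J)"
  unfolding is_ideal_def
proof (intro conjI ballI allI)
  show "0 \<in> ideal_sum I J"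
    using is_idealD(1)[OF assms(1)] is_idealD(1)[OF assms(2)] by (force simp: ideal_sum_def)
next
  fix x y assume "x \<in> ideal_sum I J" "y \<in> ideal_sum I J"
  then obtain a b c d where "x = a + b" "y = c + d" "a \<in> I" "b \<in> J" "c \<in> I" "d \<in> J"
    by (auto simp: ideal_sum_def)
  then have "x + y = (a + c) + (b + d)" "a + c \<in> I" "b + d \<in> J"
    using assms by (auto intro: is_idealD)
  then show "x + y \<in> ideal_sum I J" by (auto simp: ideal_sum_def)
next
  fix x r assume "x \<in> ideal_sum I J"
  then obtain a b where "x = a + b" "a \<in> I" "b \<in> J" by (auto simp: ideal_sum_def)
  then have "r * x = r * a + r * b" "r * a \<in> I" "r * b \<in> J"
    using assms by (auto intro: is_idealD simp: distrib_left)
  then show "r * x \<in> ideal_sum I J" by (auto simp: ideal_sum_def)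
qed

lemma ideal_sum_upper:
  assumes "is_ideal I" "is_ideal J"
  shows "I \<subseteq> ideal_sum I J" "J \<subseteq> ideal_sum I J"
  using is_idealD(1)[OF assms(1)] is_idealD(1)[OF assms(2)]
  by (force simp: ideal_sum_def)+

lemma ideal_sum_least: "is_ideal L \<Longrightarrow> I \<subseteq> L \<Longrightarrow> J \<subseteq> L \<Longrightarrow> ideal_sum I J \<subseteq> L"
  by (auto simp: ideal_sum_def intro!: is_idealD(2))

lemma is_ideal_ideal_pow: "is_ideal (ideal_pow I k)"
  by (cases k) (auto simp: is_ideal_UNIV is_ideal_ideal_prod)

lemma power_mem_ideal_pow: "a \<in> I \<Longrightarrow> a ^ k \<in> ideal_pow I k"
  by (induction k) (auto intro: ideal_prodI)

lemma subset_colon: "is_ideal I \<Longrightarrow> I \<subseteq> colon I J"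
  by (auto simp: colon_def intro: is_idealD)

text \<open>Makes multiplicative inclusions checkable on generators: the multipliers sending
  \<open>A\<close> into \<open>L\<close> form an ideal, so testing a generating set of one factor is
  enough.\<close>

lemma is_ideal_conductor:
  assumes "is_ideal L"
  shows "is_ideal {a. \<forall>b\<in>A. a * b \<in> L}"
  using is_idealD(1-3)[OF assms] by (auto simp: is_ideal_def distrib_right mult.assoc)

lemma is_ideal_colon: "is_ideal I \<Longrightarrow> is_ideal (colon I J)"
  unfolding colon_def by (rule is_ideal_conductor)

lemma prime_ideal_power:
  assumes "prime_ideal P" "a ^ m \<in> P"
  shows "a \<in> P"
  using assms(2)
proof (induction m)
  case 0
  then have "1 \<in> P" by simp
  then have "P = UNIV"
    using assms(1) is_idealD(3)[of P 1] by (auto simp: prime_ideal_def)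
  then show ?case by simp
next
  case (Suc m)
  then show ?case using assms(1) by (auto simp: prime_ideal_def)
qed

section \<open>Homogeneous polynomials and graded ideals\<close>

lemma mdeg_eq_sum: "mdeg (m :: 'n::finite \<Rightarrow>\<^sub>0 nat) = (\<Sum>i\<in>UNIV. Poly_Mapping.lookup m i)"
  unfolding mdeg_def by (rule sum.mono_neutral_left) (auto simp: in_keys_iff)

lemma mdeg_add: "mdeg (a + b :: 'n::finite \<Rightarrow>\<^sub>0 nat) = mdeg a + mdeg b"
  by (simp add: mdeg_eq_sum lookup_add sum.distrib)

lemma lookup_hcomp: "Poly_Mapping.lookup (hcomp d f) m = (if mdeg m = d then Poly_Mapping.lookup f m else 0)"
  by (auto simp: hcomp_def lookup_mapp when_def in_keys_iff)

lemma hcomp_add: "hcomp d (f + g) = hcomp d f + hcomp d g"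
  by (rule poly_mapping_eqI) (simp add: lookup_hcomp lookup_add)

lemma hcomp_diff: "hcomp d (f - g) = hcomp d f - hcomp d g"
  by (rule poly_mapping_eqI) (simp add: lookup_hcomp lookup_minus)

lemma hcomp_zero [simp]: "hcomp d 0 = 0"
  by (rule poly_mapping_eqI) (simp add: lookup_hcomp)

lemma hcomp_sum: "hcomp d (sum f A) = (\<Sum>x\<in>A. hcomp d (f x))"
  by (induction A rule: infinite_finite_induct) (auto simp: hcomp_add)

lemma homog_hcomp: "homog d (hcomp d f)"
  by (auto simp: homog_def in_keys_iff lookup_hcomp split: if_splits)

lemma hcomp_homog: "homog d f \<Longrightarrow> hcomp e f = (if e = d then f else 0)"
  by (rule poly_mapping_eqI) (auto simp: homog_def in_keys_iff lookup_hcomp)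

lemma homog_mult:
  fixes f g :: "('n::finite, 'k::field) mpoly"
  shows "homog d f \<Longrightarrow> homog e g \<Longrightarrow> homog (d + e) (f * g)"
  using keys_mult[of f g] by (fastforce simp: homog_def mdeg_add)

lemma homog_one: "homog 0 (1 :: ('n::finite, 'k::field) mpoly)"
  by (simp add: homog_def mdeg_def)

lemma homog_power:
  fixes f :: "('n::finite, 'k::field) mpoly"
  shows "homog d f \<Longrightarrow> homog (d * m) (f ^ m)"
  by (induction m) (auto simp: homog_one intro: homog_mult)

lemma homog_prod:
  fixes f :: "'i \<Rightarrow> ('n::finite, 'k::field) mpoly"
  assumes "\<And>i. i \<in> A \<Longrightarrow> homog (d i) (f i)"
  shows "homog (sum d A) (prod f A)"
  using assms by (induction A rule: infinite_finite_induct) (auto simp: homog_one intro: homog_mult)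

lemma homog_const: "homog 0 (Poly_Mapping.single 0 c :: ('n::finite, 'k::field) mpoly)"
  by (simp add: homog_def mdeg_def)

lemma homog_var: "homog 1 (var i :: ('n::finite, 'k::field) mpoly)"
  by (simp add: homog_def var_def mdeg_def)

lemma sum_hcomp: "(\<Sum>d\<in>mdeg ` Poly_Mapping.keys f. hcomp d f) = f"
proof (rule poly_mapping_eqI)
  fix m
  show "Poly_Mapping.lookup (\<Sum>d\<in>mdeg ` Poly_Mapping.keys f. hcomp d f) m = Poly_Mapping.lookup f m"
    by (cases "m \<in> Poly_Mapping.keys f") (auto simp: lookup_sum lookup_hcomp in_keys_iff)
qed

lemma hcomp_homog_mult:
  fixes g p :: "('n::finite, 'k::field) mpoly"
  assumes "homog e g"
  shows "hcomp d (g * p) = (if e \<le> d then g * hcomp (d - e) p else 0)"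
proof -
  have hom: "homog (e + i) (g * hcomp i p)" for i
    using assms homog_hcomp by (rule homog_mult)
  let ?A = "mdeg ` Poly_Mapping.keys p"
  have "g * p = (\<Sum>i\<in>?A. g * hcomp i p)"
    by (simp add: sum_hcomp flip: sum_distrib_left)
  then have "hcomp d (g * p) = (\<Sum>i\<in>?A. if d = e + i then g * hcomp i p else 0)"
    by (simp add: hcomp_sum hcomp_homog[OF hom])
  also have "\<dots> = (if e \<le> d then \<Sum>i\<in>?A. if i = d - e then g * hcomp i p else 0 else 0)"
  proof (cases "e \<le> d")
    case True
    then have "d = e + i \<longleftrightarrow> i = d - e" for i by auto
    then show ?thesis using True by simp
  next
    case False
    then have "d \<noteq> e + i" for i by auto
    then show ?thesis using False by simp
  qed
  also have "\<dots> = (if e \<le> d then g * hcomp (d - e) p else 0)"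
  proof -
    have "hcomp (d - e) p = 0" if "d - e \<notin> ?A"
    proof (rule poly_mapping_eqI)
      fix m show "Poly_Mapping.lookup (hcomp (d - e) p) m = Poly_Mapping.lookup 0 m"
        using that by (metis image_eqI in_keys_iff lookup_hcomp lookup_zero)
    qed
    then show ?thesis by (auto simp: sum.delta')
  qed
  finally show ?thesis .
qed

lemma single_eq_prod_var:
  "Poly_Mapping.single m 1 = (\<Prod>i\<in>UNIV. var i ^ Poly_Mapping.lookup m i :: ('n::finite, 'k::field) mpoly)"
proof -
  have pow: "(var i :: ('n, 'k) mpoly) ^ e = Poly_Mapping.single (Poly_Mapping.single i e) 1" for i e
    by (induction e) (auto simp: var_def mult_single single_add[symmetric])
  have "(\<Prod>i\<in>A. Poly_Mapping.single (f i) (1 :: 'k)) = Poly_Mapping.single (sum f A) 1"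
    for A :: "'n set" and f :: "'n \<Rightarrow> 'n \<Rightarrow>\<^sub>0 nat"
    by (induction A rule: infinite_finite_induct) (auto simp: mult_single)
  moreover have "(\<Sum>i\<in>UNIV. Poly_Mapping.single i (Poly_Mapping.lookup m i)) = m"
    by (rule poly_mapping_eqI) (simp add: lookup_sum lookup_single when_def)
  ultimately show ?thesis by (simp add: pow)
qed

text \<open>Monomials are products of variables, so everything is reached from 1 by variables,
  scalars and sums; zero is the multiple by the scalar 0.\<close>

lemma mpoly_induct [case_names add const_mult one var_mult]:
  fixes p :: "('n::finite, 'k::field) mpoly"
  assumes add: "\<And>p q. Q p \<Longrightarrow> Q q \<Longrightarrow> Q (p + q)"
    and const_mult: "\<And>c p. Q p \<Longrightarrow> Q (Poly_Mapping.single 0 c * p)"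
    and one: "Q 1"
    and var_mult: "\<And>i p. Q p \<Longrightarrow> Q (var i * p)"
  shows "Q p"
proof -
  have zero: "Q 0"
    using const_mult[OF one, of 0] by simp
  have pow: "Q q \<Longrightarrow> Q (var i ^ e * q)" for i e q
    by (induction e) (auto simp: var_mult mult.assoc)
  have prod: "Q (\<Prod>i\<in>A. var i ^ Poly_Mapping.lookup m i)" for A :: "'n set" and m
    by (induction A rule: infinite_finite_induct) (auto simp: one pow)
  have single: "Q (Poly_Mapping.single m c)" for m c
    using const_mult[OF prod[of m UNIV], of c] by (simp add: mult_single flip: single_eq_prod_var)
  have sum: "Q (sum f A)" if "\<And>x. Q (f x)" for f :: "('n \<Rightarrow>\<^sub>0 nat) \<Rightarrow> ('n, 'k) mpoly" and A
    using that by (induction A rule: infinite_finite_induct) (auto simp: zero add)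
  have "Q (\<Sum>m\<in>Poly_Mapping.keys p. Poly_Mapping.single m (Poly_Mapping.lookup p m))"
    by (rule sum) (rule single)
  also have "(\<Sum>m\<in>Poly_Mapping.keys p. Poly_Mapping.single m (Poly_Mapping.lookup p m)) = p"
    by (rule poly_mapping_eqI) (auto simp: lookup_sum lookup_single when_def in_keys_iff)
  finally show ?thesis .
qed

text \<open>Recognises a K-span as an ideal: scalars and sums come for free there, and only
  multiplication by variables remains to be checked.\<close>

lemma is_ideal_mpolyI:
  fixes T :: "('n::finite, 'k::field) mpoly set"
  assumes "0 \<in> T" and add: "\<And>x y. x \<in> T \<Longrightarrow> y \<in> T \<Longrightarrow> x + y \<in> T"
    and const: "\<And>c x. x \<in> T \<Longrightarrow> Poly_Mapping.single 0 c * x \<in> T"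
    and var: "\<And>i x. x \<in> T \<Longrightarrow> var i * x \<in> T"
  shows "is_ideal T"
proof -
  have "\<forall>x\<in>T. r * x \<in> T" for r
    by (induction r rule: mpoly_induct) (auto simp: add const var distrib_right mult.assoc)
  then show ?thesis using assms(1) add by (auto simp: is_ideal_def)
qed

text \<open>Leading terms multiply without cancellation in a linear order compatible with addition.
  The result permits cancelling \<open>a\<close> in Artin-Rees.\<close>

lemma mpoly_no_zero_divisors:
  fixes p q :: "('n::finite, 'k::field) mpoly"
  assumes "p \<noteq> 0" "q \<noteq> 0"
  shows "p * q \<noteq> 0"
proof -
  \<comment> \<open>The index type \<open>'n\<close> carries no order. Renaming its elements by
    natural numbers gives exponents that the lexicographic order compares.\<close>
  obtain idx :: "'n \<Rightarrow> nat" where idx: "inj idx"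
    using finite_imp_inj_to_nat_seg[of "UNIV :: 'n set"] by auto
  define \<theta> :: "('n \<Rightarrow>\<^sub>0 nat) \<Rightarrow> (nat \<Rightarrow>\<^sub>0 nat)"
    where "\<theta> m = (\<Sum>i\<in>UNIV. Poly_Mapping.single (idx i) (Poly_Mapping.lookup m i))" for m
  have \<theta>_add: "\<theta> (a + b) = \<theta> a + \<theta> b" for a b
    by (simp add: \<theta>_def lookup_add single_add sum.distrib)
  have "Poly_Mapping.lookup (\<theta> m) (idx i) = Poly_Mapping.lookup m i" for m i
    by (simp add: \<theta>_def lookup_sum lookup_single when_def inj_eq[OF idx])
  then have inj: "\<theta> a = \<theta> b \<Longrightarrow> a = b" for a b
    by (metis poly_mapping_eqI)
  have lead: "\<exists>m c r'. c \<noteq> 0 \<and> r = Poly_Mapping.single m c + r' \<and> (\<forall>m'\<in>Poly_Mapping.keys r'. \<theta> m' < \<theta> m)"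
    if "r \<noteq> 0" for r :: "('n, 'k) mpoly"
  proof -
    have fin: "finite (\<theta> ` Poly_Mapping.keys r)" "\<theta> ` Poly_Mapping.keys r \<noteq> {}"
      using that by (auto simp: keys_eq_empty)
    then obtain m where m: "m \<in> Poly_Mapping.keys r" "\<theta> m = Max (\<theta> ` Poly_Mapping.keys r)"
      using Max_in[OF fin] by (metis (no_types, lifting) imageE)
    let ?r = "r - Poly_Mapping.single m (Poly_Mapping.lookup r m)"
    have "\<theta> m' < \<theta> m" if "m' \<in> Poly_Mapping.keys ?r" for m'
    proof -
      have "m' \<noteq> m" "m' \<in> Poly_Mapping.keys r"
        using that by (auto simp: in_keys_iff lookup_minus lookup_single when_def split: if_splits)
      then show ?thesis
        using Max_ge[OF fin(1), of "\<theta> m'"] m(2) inj[of m' m] by (auto simp: order_less_le)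
    qed
    then show ?thesis
      using m(1) by (intro exI[of _ m] exI[of _ "Poly_Mapping.lookup r m"] exI[of _ ?r]) (auto simp: in_keys_iff)
  qed
  obtain m c p' where p: "c \<noteq> 0" "p = Poly_Mapping.single m c + p'" "\<forall>m'\<in>Poly_Mapping.keys p'. \<theta> m' < \<theta> m"
    using lead[OF assms(1)] by blast
  obtain n b q' where q: "b \<noteq> 0" "q = Poly_Mapping.single n b + q'" "\<forall>m'\<in>Poly_Mapping.keys q'. \<theta> m' < \<theta> n"
    using lead[OF assms(2)] by blast
  have q_le: "\<theta> m' \<le> \<theta> n" if "m' \<in> Poly_Mapping.keys q" for m'
  proof -
    have "m' = n \<or> m' \<in> Poly_Mapping.keys q'"
      using that keys_add[of "Poly_Mapping.single n b" q'] q(1,2) by auto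
    then show ?thesis using q(3) by auto
  qed
  have "m + n \<notin> Poly_Mapping.keys (p' * q)"
  proof
    assume "m + n \<in> Poly_Mapping.keys (p' * q)"
    then obtain a d where ad: "m + n = a + d" "a \<in> Poly_Mapping.keys p'" "d \<in> Poly_Mapping.keys q"
      using keys_mult[of p' q] by blast
    then have "\<theta> a + \<theta> d < \<theta> m + \<theta> n"
      using p(3) q_le by (intro add_less_le_mono) auto
    then show False using ad(1) by (metis \<theta>_add less_irrefl)
  qed
  moreover have "m + n \<notin> Poly_Mapping.keys (Poly_Mapping.single m c * q')"
  proof
    assume "m + n \<in> Poly_Mapping.keys (Poly_Mapping.single m c * q')"
    then obtain d where "m + n = m + d" "d \<in> Poly_Mapping.keys q'"
      using keys_mult[of "Poly_Mapping.single m c" q'] p(1) by auto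
    then show False using q(3) by auto
  qed
  moreover have "p * q = Poly_Mapping.single (m + n) (c * b) + Poly_Mapping.single m c * q' + p' * q"
    by (simp add: p(2) q(2) distrib_left distrib_right mult_single)
  ultimately have "Poly_Mapping.lookup (p * q) (m + n) = c * b"
    by (simp add: lookup_add in_keys_iff)
  then show ?thesis using p(1) q(1) by auto
qed


section \<open>Graded ideals: operations, multiplication by variables, Nakayama's lemma\<close>

lemma graded_idealD: "graded_ideal I \<Longrightarrow> is_ideal I" "graded_ideal I \<Longrightarrow> f \<in> I \<Longrightarrow> hcomp d f \<in> I"
  by (auto simp: graded_ideal_def)

lemma hcomp_const_mult:
  "hcomp d (Poly_Mapping.single 0 c * p) = Poly_Mapping.single 0 c * hcomp d (p :: ('n::finite, 'k::field) mpoly)"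
  by (simp add: hcomp_homog_mult[OF homog_const])

lemma hcomp_var_mult:
  "hcomp d (var i * p) = (if d = 0 then 0 else var i * hcomp (d - 1) (p :: ('n::finite, 'k::field) mpoly))"
  by (simp add: hcomp_homog_mult[OF homog_var])

text \<open>A variable moves the component of degree \<open>d - 1\<close> into degree
  \<open>d\<close>, which is what monotonicity of \<open>L\<close> absorbs. It is used for a
  constant \<open>L\<close> and for the ideals generated below degree \<open>d\<close>.\<close>

lemma is_ideal_hcomp_filtration:
  fixes L :: "nat \<Rightarrow> ('n::finite, 'k::field) mpoly set"
  assumes ideal: "\<And>d. is_ideal (L d)" and mono: "\<And>d. L d \<subseteq> L (Suc d)"
  shows "is_ideal {f. \<forall>d. hcomp d f \<in> L d}"
proof (rule is_ideal_mpolyI)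
  fix i x assume "x \<in> {f. \<forall>d. hcomp d f \<in> L d}"
  then have "var i * hcomp (d - 1) x \<in> L d" if "d \<noteq> 0" for d
    using that is_idealD(3)[OF ideal] mono[of "d - 1"] by auto
  then show "var i * x \<in> {f. \<forall>d. hcomp d f \<in> L d}"
    using is_idealD(1)[OF ideal] by (auto simp: hcomp_var_mult)
qed (use is_idealD(1-3)[OF ideal] in \<open>auto simp: hcomp_add hcomp_const_mult\<close>)

lemma is_ideal_hcomp_in:
  fixes L :: "('n::finite, 'k::field) mpoly set"
  assumes "is_ideal L"
  shows "is_ideal {f. \<forall>d. hcomp d f \<in> L}"
  by (rule is_ideal_hcomp_filtration) (use assms in auto)

lemma graded_ideal_UNIV: "graded_ideal UNIV"
  by (simp add: graded_ideal_def is_ideal_UNIV)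

lemma graded_ideal_ideal_prod:
  fixes I J :: "('n::finite, 'k::field) mpoly set"
  assumes "graded_ideal I" "graded_ideal J"
  shows "graded_ideal (ideal_prod I J)"
proof -
  have "hcomp d (a * b) \<in> ideal_prod I J" if "a \<in> I" "b \<in> J" for a b d
  proof -
    have "hcomp d (hcomp i a * b) \<in> ideal_prod I J" for i
      using that assms
      by (auto simp: hcomp_homog_mult[OF homog_hcomp] graded_idealD
          intro: ideal_prodI is_idealD(1)[OF is_ideal_ideal_prod])
    then have "(\<Sum>i\<in>mdeg ` Poly_Mapping.keys a. hcomp d (hcomp i a * b)) \<in> ideal_prod I J"
      by (intro is_ideal_sum is_ideal_ideal_prod)
    also have "(\<Sum>i\<in>mdeg ` Poly_Mapping.keys a. hcomp d (hcomp i a * b)) = hcomp d (a * b)"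
      by (simp add: sum_hcomp flip: hcomp_sum sum_distrib_right)
    finally show ?thesis .
  qed
  then have "ideal_prod I J \<subseteq> {f. \<forall>d. hcomp d f \<in> ideal_prod I J}"
    by (intro ideal_prod_least is_ideal_hcomp_in is_ideal_ideal_prod) auto
  then show ?thesis by (auto simp: graded_ideal_def is_ideal_ideal_prod)
qed

lemma graded_ideal_ideal_pow:
  fixes I :: "('n::finite, 'k::field) mpoly set"
  shows "graded_ideal I \<Longrightarrow> graded_ideal (ideal_pow I k)"
  by (induction k) (auto simp: graded_ideal_UNIV graded_ideal_ideal_prod)

lemma graded_ideal_ideal_sum:
  "graded_ideal I \<Longrightarrow> graded_ideal J \<Longrightarrow> graded_ideal (ideal_sum I J)"
  unfolding graded_ideal_def
  by (intro conjI is_ideal_ideal_sum) (fastforce simp: ideal_sum_def hcomp_add)+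

lemma graded_ideal_max_ideal: "graded_ideal (max_ideal :: ('n::finite, 'k::field) mpoly set)"
proof -
  have ideal: "is_ideal (max_ideal :: ('n, 'k) mpoly set)"
    by (simp add: max_ideal_def is_ideal_ideal_gen)
  have "var i \<in> (max_ideal :: ('n, 'k) mpoly set)" for i
    unfolding max_ideal_def by (rule subsetD[OF ideal_gen_superset]) blast
  then have "max_ideal \<subseteq> {f :: ('n, 'k) mpoly. \<forall>d. hcomp d f \<in> max_ideal}"
    using ideal is_idealD(1)[OF ideal]
    by (subst (1) max_ideal_def, intro ideal_gen_least is_ideal_hcomp_in) (auto simp: hcomp_homog[OF homog_var])
  then show ?thesis using ideal by (auto simp: graded_ideal_def)
qed

text \<open>Against a homogeneous element of \<open>P\<close> the products with the components of
  \<open>f\<close> are the components of the product with \<open>f\<close>; gradedness of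
  \<open>P\<close> reduces a general element to this case.\<close>

lemma graded_ideal_colon:
  fixes N P :: "('n::finite, 'k::field) mpoly set"
  assumes N: "graded_ideal N" and P: "graded_ideal P"
  shows "graded_ideal (colon N P)"
  unfolding graded_ideal_def
proof (intro conjI ballI allI)
  show "is_ideal (colon N P)"
    by (rule is_ideal_colon[OF graded_idealD(1)[OF N]])
next
  fix f d assume f: "f \<in> colon N P"
  have "hcomp d f * h \<in> N" if "h \<in> P" for h
  proof -
    have "hcomp d f * hcomp i h \<in> N" for i
    proof -
      have "hcomp (i + d) (hcomp i h * f) \<in> N"
        using f that P by (intro graded_idealD[OF N]) (auto simp: colon_def graded_idealD mult.commute)
      then have "hcomp i h * hcomp d f \<in> N" by (simp add: hcomp_homog_mult[OF homog_hcomp])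
      then show ?thesis by (simp add: mult.commute)
    qed
    then have "(\<Sum>i\<in>mdeg ` Poly_Mapping.keys h. hcomp d f * hcomp i h) \<in> N"
      by (intro is_ideal_sum graded_idealD(1)[OF N])
    then show ?thesis by (simp add: sum_hcomp flip: sum_distrib_left)
  qed
  then show "hcomp d f \<in> colon N P" by (auto simp: colon_def)
qed

lemma var_mult_max_ideal: "x \<in> J \<Longrightarrow> var i * x \<in> ideal_prod max_ideal J"
  unfolding max_ideal_def by (intro ideal_prodI subsetD[OF ideal_gen_superset]) auto

text \<open>Variables raise the degree, so the part of an element of \<open>mJ\<close> in degree
  \<open>d\<close> uses only elements of \<open>J\<close> of smaller degree. This strict drop drives
  the induction in \<open>graded_nakayama\<close>.\<close>

lemma hcomp_max_ideal_prod:
  fixes J :: "('n::finite, 'k::field) mpoly set"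
  assumes J: "graded_ideal J" and "f \<in> ideal_prod max_ideal J"
  shows "hcomp d f \<in> ideal_gen {g. \<exists>e<d. homog e g \<and> g \<in> J}"
proof -
  let ?G = "\<lambda>d. ideal_gen {g. \<exists>e<d. homog e g \<and> g \<in> J}"
  let ?L = "{f. \<forall>d. hcomp d f \<in> ?G d}"
  have L: "is_ideal ?L"
    by (intro is_ideal_hcomp_filtration is_ideal_ideal_gen ideal_gen_mono) (auto intro: less_SucI)
  have "var i * b \<in> ?L" if "b \<in> J" for i b
  proof -
    have "var i * hcomp (d - 1) b \<in> ?G d" if "d \<noteq> 0" for d
      using that \<open>b \<in> J\<close>
      by (intro is_idealD(3)[OF is_ideal_ideal_gen] subsetD[OF ideal_gen_superset])
        (auto intro!: exI[of _ "d - 1"] homog_hcomp graded_idealD(2)[OF J])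
    then show ?thesis by (auto simp: hcomp_var_mult is_idealD(1)[OF is_ideal_ideal_gen])
  qed
  then have "max_ideal \<subseteq> {a. \<forall>b\<in>J. a * b \<in> ?L}"
    unfolding max_ideal_def by (intro ideal_gen_least is_ideal_conductor L) auto
  then have "ideal_prod max_ideal J \<subseteq> ?L"
    by (intro ideal_prod_least L) auto
  then show ?thesis using assms(2) by auto
qed

text \<open>An element of \<open>N + mJ\<close> of degree \<open>d\<close> is, up to
  \<open>N\<close>, a combination of elements of \<open>J\<close> of smaller degree, and induction
  on \<open>d\<close> takes over. The bound \<open>e \<le> d\<close> is kept because it determines
  alpha.\<close>

lemma graded_nakayama:
  fixes N J :: "('n::finite, 'k::field) mpoly set"
  assumes N: "graded_ideal N" and J: "graded_ideal J"
    and "homog d f" "f \<in> J"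
  shows "f \<in> ideal_gen (N \<union> {g. \<exists>e\<le>d. homog e g \<and> g \<in> J \<and> g \<notin> ideal_sum N (ideal_prod max_ideal J)})"
  using assms(3,4)
proof (induction d arbitrary: f rule: less_induct)
  case (less d)
  let ?G = "\<lambda>d. N \<union> {g. \<exists>e\<le>d. homog e g \<and> g \<in> J \<and> g \<notin> ideal_sum N (ideal_prod max_ideal J)}"
  show ?case
  proof (cases "f \<in> ideal_sum N (ideal_prod max_ideal J)")
    case False
    then show ?thesis using less.prems by (intro subsetD[OF ideal_gen_superset]) auto
  next
    case True
    then obtain a b where ab: "f = a + b" "a \<in> N" "b \<in> ideal_prod max_ideal J"
      by (auto simp: ideal_sum_def)
    have "{g. \<exists>e<d. homog e g \<and> g \<in> J} \<subseteq> ideal_gen (?G d)"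
    proof clarify
      fix g e assume e: "e < d" "homog e g" "g \<in> J"
      have "?G e \<subseteq> ?G d" using e(1) by (auto dest: less_imp_le order_trans)
      then show "g \<in> ideal_gen (?G d)"
        using less.IH[OF e] ideal_gen_mono by blast
    qed
    then have "hcomp d b \<in> ideal_gen (?G d)"
      using hcomp_max_ideal_prod[OF J ab(3)] ideal_gen_least[OF is_ideal_ideal_gen] by blast
    moreover have "hcomp d a \<in> ideal_gen (?G d)"
      using graded_idealD(2)[OF N ab(2)] by (intro subsetD[OF ideal_gen_superset]) auto
    ultimately have "hcomp d f \<in> ideal_gen (?G d)"
      by (simp add: ab(1) hcomp_add is_idealD(2)[OF is_ideal_ideal_gen])
    then show ?thesis using less.prems(1) by (simp add: hcomp_homog)
  qed
qed

section \<open>Associated primes of graded ideals\<close>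

text \<open>The witness \<open>f\<close> need not be homogeneous, so components of \<open>p\<close>
  cannot be tested against it directly. Primeness helps: it suffices that a power of the lowest
  component of \<open>p\<close> sends \<open>f\<close> into \<open>N\<close>.\<close>

lemma graded_ideal_Ass:
  fixes N P :: "('n::finite, 'k::field) mpoly set"
  assumes N: "graded_ideal N" and P: "P \<in> Ass N"
  shows "graded_ideal P"
proof -
  obtain f where f: "colon_elem N f = P" and prime: "prime_ideal P"
    using P by (auto simp: Ass_def)
  have P_ideal: "is_ideal P" using prime by (simp add: prime_ideal_def)
  have N_ideal: "is_ideal N" by (rule graded_idealD(1)[OF N])
  define low where "low s p \<longleftrightarrow> (\<forall>i<s. hcomp i p = 0)" for s and p :: "('n, 'k) mpoly"
  have low_mult: "hcomp (s + t) (p * q) = hcomp s p * hcomp t q" if "low s p" "low t q" for s t p q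
  proof -
    have "hcomp (s + t) (hcomp i p * q) = (if i = s then hcomp s p * hcomp t q else 0)" for i
    proof -
      have "hcomp i p * hcomp (s + t - i) q = 0" if "i \<noteq> s" "i \<le> s + t"
      proof (cases "i < s")
        case True
        then show ?thesis using \<open>low s p\<close> by (simp add: low_def)
      next
        case False
        then have "s + t - i < t" using that by auto
        then show ?thesis using \<open>low t q\<close> by (simp add: low_def)
      qed
      then show ?thesis by (auto simp: hcomp_homog_mult[OF homog_hcomp])
    qed
    moreover have "hcomp (s + t) (p * q) = (\<Sum>i\<in>mdeg ` Poly_Mapping.keys p. hcomp (s + t) (hcomp i p * q))"
      by (simp add: sum_hcomp flip: hcomp_sum sum_distrib_right)
    moreover have "hcomp s p = 0" if "s \<notin> mdeg ` Poly_Mapping.keys p"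
      using that by (intro poly_mapping_eqI) (metis image_eqI in_keys_iff lookup_hcomp lookup_zero)
    ultimately show ?thesis by auto
  qed
  \<comment> \<open>Comparing lowest components, a power of the lowest component of an element of the
    annihilator of \<open>f\<close> kills the components of \<open>f\<close> one after the other.\<close>
  have power: "hcomp s p ^ m * q \<in> N"
    if "low s p" "p * q \<in> N" "low t q" "\<forall>i\<ge>t + m. hcomp i q = 0" for s t m p q
    using that(2-4)
  proof (induction m arbitrary: t q)
    case 0
    then have "hcomp i q = 0" for i by (auto simp: low_def not_le[symmetric])
    then have "q = 0" using sum_hcomp[of q] by simp
    then show ?case using is_idealD(1)[OF N_ideal] by simp
  next
    case (Suc m)
    let ?q = "q - hcomp t q"
    have *: "hcomp s p * hcomp t q \<in> N"
      using low_mult[OF that(1) Suc.prems(2)] graded_idealD(2)[OF N Suc.prems(1)] by metis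
    have "p * (hcomp s p * ?q) = hcomp s p * (p * q) - p * (hcomp s p * hcomp t q)"
      by (simp add: algebra_simps)
    then have "p * (hcomp s p * ?q) \<in> N"
      using Suc.prems(1) * is_idealD(3,6)[OF N_ideal] by metis
    moreover have comp: "hcomp i (hcomp s p * ?q) = (if s \<le> i \<and> i - s \<noteq> t then hcomp s p * hcomp (i - s) q else 0)" for i
      by (simp add: hcomp_homog_mult[OF homog_hcomp] hcomp_diff hcomp_homog[OF homog_hcomp])
    have "low (s + Suc t) (hcomp s p * ?q)"
      using Suc.prems(2) by (auto simp: low_def comp less_Suc_eq)
    moreover have "\<forall>i\<ge>s + Suc t + m. hcomp i (hcomp s p * ?q) = 0"
      using Suc.prems(3) by (auto simp: comp)
    ultimately have "hcomp s p ^ m * (hcomp s p * ?q) \<in> N"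
      by (intro Suc.IH)
    moreover have "hcomp s p ^ Suc m * q = hcomp s p ^ m * (hcomp s p * ?q) + hcomp s p ^ m * (hcomp s p * hcomp t q)"
      by (simp add: algebra_simps)
    ultimately show ?case
      using * is_idealD(2,3)[OF N_ideal] by metis
  qed
  have f_bound: "\<exists>m. \<forall>i\<ge>m. hcomp i f = 0"
  proof (intro exI allI impI poly_mapping_eqI)
    fix i m assume i: "Suc (Max (insert 0 (mdeg ` Poly_Mapping.keys f))) \<le> i"
    have "mdeg m \<noteq> i" if "m \<in> Poly_Mapping.keys f"
    proof -
      have "mdeg m \<le> Max (insert 0 (mdeg ` Poly_Mapping.keys f))"
        using that by (intro Max_ge) auto
      then show ?thesis using i by linarith
    qed
    then show "Poly_Mapping.lookup (hcomp i f) m = Poly_Mapping.lookup 0 m"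
      by (auto simp: lookup_hcomp in_keys_iff)
  qed
  then obtain m where m: "\<forall>i\<ge>m. hcomp i f = 0" by blast
  have lowest: "hcomp s p \<in> P" if "p \<in> P" "low s p" for s p
  proof -
    have "hcomp s p ^ m * f \<in> N"
      using power[OF that(2), of f 0 m] that(1) m f by (auto simp: colon_elem_def low_def)
    then have "hcomp s p ^ m \<in> P" using f by (auto simp: colon_elem_def)
    then show ?thesis by (rule prime_ideal_power[OF prime])
  qed
  have "hcomp d p \<in> P" if "p \<in> P" for d p
  proof (induction d rule: less_induct)
    case (less d)
    \<comment> \<open>The lower components lie in \<open>P\<close> by induction; removing them
      leaves an element of \<open>P\<close> without components below degree
      \<open>d\<close>.\<close>
    let ?p = "p - (\<Sum>i<d. hcomp i p)"
    have "?p \<in> P"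
      using that less by (intro is_idealD(6)[OF P_ideal] is_ideal_sum[OF P_ideal]) auto
    moreover have comp: "hcomp j ?p = (if j < d then 0 else hcomp j p)" for j
      by (simp add: hcomp_diff hcomp_sum hcomp_homog[OF homog_hcomp])
    then have "low d ?p" by (simp add: low_def)
    ultimately have "hcomp d ?p \<in> P" by (rule lowest)
    then show ?case by (simp add: comp)
  qed
  then show ?thesis using P_ideal by (simp add: graded_ideal_def)
qed

text \<open>Localisation at \<open>P\<close> in elementary terms: \<open>?L\<close> is the set of
  elements that vanish in the localisation of the ring modulo \<open>N\<close>. If all of
  \<open>G\<close> vanished there, so would \<open>g\<close>, but
  \<open>colon_elem N g \<subseteq> P\<close> says that \<open>g\<close> survives.\<close>

lemma prime_ideal_inter_colon_elem:
  assumes prime: "prime_ideal P" and N: "is_ideal N"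
    and g: "g \<in> ideal_gen (N \<union> G)" "colon_elem N g \<subseteq> P"
  shows "\<exists>h\<in>G. colon_elem N h \<subseteq> P"
proof (rule ccontr)
  assume neg: "\<not> (\<exists>h\<in>G. colon_elem N h \<subseteq> P)"
  let ?L = "{x. \<exists>s. s \<notin> P \<and> s * x \<in> N}"
  have P: "is_ideal P" and one: "1 \<notin> P"
    using prime is_idealD(3)[of P 1] by (auto simp: prime_ideal_def)
  have "is_ideal ?L"
    unfolding is_ideal_def
  proof (intro conjI ballI allI)
    show "0 \<in> ?L" using one is_idealD(1)[OF N] by auto
  next
    fix x y assume "x \<in> ?L" "y \<in> ?L"
    then obtain s t where st: "s \<notin> P" "s * x \<in> N" "t \<notin> P" "t * y \<in> N" by auto
    have "s * t \<notin> P" using st prime by (auto simp: prime_ideal_def)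
    moreover have "s * t * (x + y) = t * (s * x) + s * (t * y)" by (simp add: algebra_simps)
    ultimately show "x + y \<in> ?L" using is_idealD(2,3)[OF N] st by (metis (mono_tags, lifting) mem_Collect_eq)
  next
    fix x r assume "x \<in> ?L"
    then obtain s where "s \<notin> P" "s * x \<in> N" by auto
    moreover have "s * (r * x) = r * (s * x)" by (simp add: algebra_simps)
    ultimately show "r * x \<in> ?L" using is_idealD(3)[OF N] by (metis (mono_tags, lifting) mem_Collect_eq)
  qed
  moreover have "N \<subseteq> ?L" using one by (auto intro: exI[of _ 1])
  moreover have "G \<subseteq> ?L" using neg by (auto simp: colon_elem_def)
  ultimately have "g \<in> ?L" using g(1) ideal_gen_least[of ?L "N \<union> G"] by blast
  then show False using g(2) by (auto simp: colon_elem_def)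
qed

text \<open>Some component of a witness has its annihilator inside \<open>P\<close>, by
  localisation; the reverse inclusion holds for every component because \<open>colon N P\<close> is
  graded.\<close>

lemma Ass_homog_witness:
  fixes N P :: "('n::finite, 'k::field) mpoly set"
  assumes N: "graded_ideal N" and P: "P \<in> Ass N"
  shows "\<exists>d f. homog d f \<and> colon_elem N f = P"
proof -
  obtain f where f: "colon_elem N f = P" and prime: "prime_ideal P"
    using P by (auto simp: Ass_def)
  have P_graded: "graded_ideal P" by (rule graded_ideal_Ass[OF N P])
  let ?G = "{g. \<exists>d. g = hcomp d f}"
  have "(\<Sum>d\<in>mdeg ` Poly_Mapping.keys f. hcomp d f) \<in> ideal_gen (N \<union> ?G)"
    by (intro is_ideal_sum is_ideal_ideal_gen subsetD[OF ideal_gen_superset]) auto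
  then have "f \<in> ideal_gen (N \<union> ?G)" by (simp add: sum_hcomp)
  then obtain d where d: "colon_elem N (hcomp d f) \<subseteq> P"
    using prime_ideal_inter_colon_elem[OF prime graded_idealD(1)[OF N]] f by blast
  have "f \<in> colon N P" using f by (auto simp: colon_def colon_elem_def mult.commute)
  then have "hcomp d f \<in> colon N P"
    by (rule graded_idealD(2)[OF graded_ideal_colon[OF N P_graded]])
  then have "P \<subseteq> colon_elem N (hcomp d f)" by (auto simp: colon_def colon_elem_def mult.commute)
  then show ?thesis using d homog_hcomp by blast
qed

section \<open>Dickson's lemma and down-closed sets of exponents\<close>

text \<open>Every tail has a least value, hence infinitely many \<open>n\<close> have
  \<open>s n\<close> below all later values; enumerating these \<open>n\<close> gives the
  subsequence.\<close>

lemma nat_seq_mono_subseq: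
  fixes s :: "nat \<Rightarrow> nat"
  shows "\<exists>\<phi> :: nat \<Rightarrow> nat. strict_mono \<phi> \<and> mono (s \<circ> \<phi>)"
proof -
  let ?good = "{n. \<forall>m\<ge>n. s n \<le> s m}"
  have "\<exists>n\<ge>N. n \<in> ?good" for N
  proof -
    obtain n where n: "n \<ge> N" "\<forall>m. m \<ge> N \<longrightarrow> s n \<le> s m"
      using ex_has_least_nat[of "\<lambda>n. n \<ge> N" N s] by blast
    then show ?thesis by (intro exI[of _ n]) auto
  qed
  then have inf: "infinite ?good" by (simp add: infinite_nat_iff_unbounded_le)
  let ?\<phi> = "enumerate ?good"
  have sm: "strict_mono ?\<phi>" by (rule strict_mono_enumerate[OF inf])
  moreover have "mono (s \<circ> ?\<phi>)"
  proof (rule monoI)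
    fix i j :: nat assume "i \<le> j"
    then have "?\<phi> i \<le> ?\<phi> j" using sm by (simp add: strict_mono_less_eq)
    then show "(s \<circ> ?\<phi>) i \<le> (s \<circ> ?\<phi>) j" using enumerate_in_set[OF inf, of i] by simp
  qed
  ultimately show ?thesis by blast
qed

lemma dickson_subseq:
  fixes s :: "nat \<Rightarrow> 'a \<Rightarrow> nat"
  assumes "finite A"
  shows "\<exists>\<phi> :: nat \<Rightarrow> nat. strict_mono \<phi> \<and> (\<forall>i\<in>A. mono (\<lambda>n. s (\<phi> n) i))"
  using assms
proof (induction A)
  case empty
  show ?case by (auto intro!: exI[of _ id] simp: strict_mono_def)
next
  case (insert a A)
  then obtain \<phi> :: "nat \<Rightarrow> nat" where \<phi>: "strict_mono \<phi>" "\<forall>i\<in>A. mono (\<lambda>n. s (\<phi> n) i)" by blast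
  obtain \<psi> :: "nat \<Rightarrow> nat" where \<psi>: "strict_mono \<psi>" "mono ((\<lambda>n. s (\<phi> n) a) \<circ> \<psi>)"
    using nat_seq_mono_subseq by blast
  have "strict_mono (\<phi> \<circ> \<psi>)"
    using \<phi>(1) \<psi>(1) by (auto simp: strict_mono_def)
  moreover have "mono (\<lambda>n. s ((\<phi> \<circ> \<psi>) n) i)" if "i \<in> A" for i
    using \<phi>(2) that \<psi>(1) by (auto simp: mono_def strict_mono_less_eq)
  ultimately show ?case using \<psi>(2) by (intro exI[of _ "\<phi> \<circ> \<psi>"]) (auto simp: comp_def)
qed

text \<open>Exponents in \<open>N\<close> indeterminates live inside
  \<open>nat \<Rightarrow>\<^sub>0 nat\<close>: \<open>N\<close> depends on how many generators
  \<open>I\<close> has, and this type has a linear order compatible with addition.\<close>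

definition mons :: "nat \<Rightarrow> (nat \<Rightarrow>\<^sub>0 nat) set" where
  "mons N = {u. Poly_Mapping.keys u \<subseteq> {..<N}}"

lemma mons_zero: "0 \<in> mons N"
  by (simp add: mons_def)

lemma mons_add: "u \<in> mons N \<Longrightarrow> v \<in> mons N \<Longrightarrow> u + v \<in> mons N"
  using keys_add[of u v] by (auto simp: mons_def)

lemma mons_diff: "u \<in> mons N \<Longrightarrow> u - v \<in> mons N"
  by (auto simp: mons_def in_keys_iff lookup_minus subset_iff)

lemma mons_single: "i < N \<Longrightarrow> Poly_Mapping.single i e \<in> mons N"
  by (auto simp: mons_def)

lemma lookup_mons: "u \<in> mons N \<Longrightarrow> i \<ge> N \<Longrightarrow> Poly_Mapping.lookup u i = 0"
  by (auto simp: mons_def in_keys_iff subset_iff)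

lemma mons_eqI:
  "u \<in> mons N \<Longrightarrow> v \<in> mons N \<Longrightarrow> (\<And>i. i < N \<Longrightarrow> Poly_Mapping.lookup u i = Poly_Mapping.lookup v i) \<Longrightarrow> u = v"
  by (rule poly_mapping_eqI) (metis lookup_mons not_le)

lemma mons_le_add_diff:
  assumes "u \<in> mons N" "v \<in> mons N" "\<forall>i<N. Poly_Mapping.lookup u i \<le> Poly_Mapping.lookup v i"
  shows "v = u + (v - u)"
  using assms by (intro mons_eqI[of _ N]) (auto simp: mons_add mons_diff lookup_add lookup_minus)

text \<open>The minimal elements for the componentwise order suffice: infinitely many of them would
  contain, by \<open>dickson_subseq\<close>, two distinct comparable ones.\<close>

lemma dickson:
  assumes "U \<subseteq> mons N"
  shows "\<exists>F\<subseteq>U. finite F \<and> (\<forall>u\<in>U. \<exists>f\<in>F. \<exists>v\<in>mons N. u = f + v)"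
proof -
  define le where "le u v \<longleftrightarrow> (\<forall>i<N. Poly_Mapping.lookup u i \<le> Poly_Mapping.lookup v i)"
    for u v :: "nat \<Rightarrow>\<^sub>0 nat"
  let ?F = "{u\<in>U. \<forall>v\<in>U. le v u \<longrightarrow> v = u}"
  have "finite ?F"
  proof (rule ccontr)
    assume "infinite ?F"
    then obtain s :: "nat \<Rightarrow> nat \<Rightarrow>\<^sub>0 nat" where s: "inj s" "range s \<subseteq> ?F"
      using infinite_countable_subset by blast
    obtain \<phi> :: "nat \<Rightarrow> nat" where \<phi>: "strict_mono \<phi>" "\<forall>i\<in>{..<N}. mono (\<lambda>n. Poly_Mapping.lookup (s (\<phi> n)) i)"
      using dickson_subseq[of "{..<N}" "\<lambda>n. Poly_Mapping.lookup (s n)"] by auto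
    then have "le (s (\<phi> 0)) (s (\<phi> 1))" by (auto simp: le_def mono_def)
    then have "s (\<phi> 0) = s (\<phi> 1)" using s(2) by blast
    then have "\<phi> 0 = \<phi> 1" using s(1) by (simp add: inj_eq)
    then show False using \<phi>(1) by (auto simp: strict_mono_eq)
  qed
  moreover have minimal: "\<exists>f\<in>?F. le f u" if "u \<in> U" for u
  proof -
    \<comment> \<open>An element of least total degree among those below \<open>u\<close> is
      minimal: anything below it has the same total, hence the same coordinates.\<close>
    let ?m = "\<lambda>v. \<Sum>i<N. Poly_Mapping.lookup v i"
    obtain f where f: "f \<in> U" "le f u" "\<forall>v. v \<in> U \<and> le v u \<longrightarrow> ?m f \<le> ?m v"
    proof -
      have "u \<in> U \<and> le u u" using \<open>u \<in> U\<close> by (simp add: le_def)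
      then have "\<exists>f. (f \<in> U \<and> le f u) \<and> (\<forall>v. v \<in> U \<and> le v u \<longrightarrow> ?m f \<le> ?m v)"
        by (rule ex_has_least_nat)
      then show ?thesis using that by blast
    qed
    have "v = f" if "v \<in> U" "le v f" for v
    proof (rule mons_eqI[of _ N])
      have "le v u" using that f(2) by (auto simp: le_def intro: order_trans)
      then have "?m f \<le> ?m v" using f(3) that by blast
      moreover have "?m v \<le> ?m f" using that by (intro sum_mono) (auto simp: le_def)
      ultimately have eq: "(\<Sum>i<N. Poly_Mapping.lookup v i) = (\<Sum>i<N. Poly_Mapping.lookup f i)" by (rule order.antisym[rotated])
      show "Poly_Mapping.lookup v i = Poly_Mapping.lookup f i" if "i < N" for i
        by (rule sum_mono_inv[OF eq]) (use \<open>le v f\<close> that in \<open>auto simp: le_def\<close>)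
    qed (use that f assms in auto)
    then show ?thesis using f by blast
  qed
  have "\<exists>f\<in>?F. \<exists>v\<in>mons N. u = f + v" if "u \<in> U" for u
  proof -
    obtain f where f: "f \<in> ?F" "le f u" using minimal[OF \<open>u \<in> U\<close>] by blast
    have "u = f + (u - f)"
      using f that assms by (intro mons_le_add_diff[of _ N]) (auto simp: le_def)
    moreover have "u - f \<in> mons N" using that assms by (intro mons_diff) auto
    ultimately show ?thesis using f(1) by blast
  qed
  ultimately show ?thesis by (intro exI[of _ ?F]) auto
qed

section \<open>Well-foundedness of the lexicographic order in finitely many indeterminates\<close>

lemma poly_mapping_nat_zero_le: "0 \<le> (v :: nat \<Rightarrow>\<^sub>0 nat)"
proof (cases "v = 0")
  case False
  then have ne: "Poly_Mapping.keys v \<noteq> {}" by simp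
  let ?k = "Min (Poly_Mapping.keys v)"
  have "Poly_Mapping.lookup v ?k > 0"
    using Min_in[OF _ ne] by (simp add: in_keys_iff)
  moreover have "Poly_Mapping.lookup v k = 0" if "k < ?k" for k
    using that Min_le[of "Poly_Mapping.keys v" k] by (meson finite_keys in_keys_iff not_le)
  ultimately have "less_fun (Poly_Mapping.lookup 0) (Poly_Mapping.lookup v)"
    by (auto simp: less_fun_def)
  then have "0 < v" by (simp add: less_poly_mapping.rep_eq)
  then show ?thesis by simp
qed simp

text \<open>Without the bound \<open>N\<close> the order has infinite descending chains, since the
  unit vectors decrease as their index grows. With \<open>N\<close> fixed, a descending chain would
  by \<open>dickson_subseq\<close> contain a term that divides a later one and so cannot exceed
  it.\<close>

lemma wf_mons: "wf {(u, v). u \<in> mons N \<and> v \<in> mons N \<and> u < v}"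
proof (rule ccontr)
  assume "\<not> ?thesis"
  then obtain s where s: "\<And>i. (s (Suc i), s i) \<in> {(u, v). u \<in> mons N \<and> v \<in> mons N \<and> u < v}"
    by (auto simp: wf_iff_no_infinite_down_chain)
  obtain \<phi> :: "nat \<Rightarrow> nat" where \<phi>: "strict_mono \<phi>" "\<forall>i\<in>{..<N}. mono (\<lambda>n. Poly_Mapping.lookup (s (\<phi> n)) i)"
    using dickson_subseq[of "{..<N}" "\<lambda>n. Poly_Mapping.lookup (s n)"] by auto
  have "s (\<phi> 1) = s (\<phi> 0) + (s (\<phi> 1) - s (\<phi> 0))"
    using s \<phi>(2) by (intro mons_le_add_diff[of _ N]) (auto simp: mono_def)
  then have "s (\<phi> 0) \<le> s (\<phi> 1)"
    by (metis add.right_neutral add_left_mono poly_mapping_nat_zero_le)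
  moreover have "s (\<phi> 1) < s (\<phi> 0)"
  proof -
    have "s (Suc (i + n)) < s i" for i n
    proof (induction n)
      case 0
      then show ?case using s[of i] by simp
    next
      case (Suc n)
      then show ?case using s[of "Suc (i + n)"] by auto
    qed
    moreover have "\<phi> 0 < \<phi> 1" using \<phi>(1) by (simp add: strict_mono_less)
    ultimately show ?thesis by (metis less_iff_Suc_add)
  qed
  ultimately show False by simp
qed

text \<open>A translated coordinate orthant, on which a linear form is easily maximised. The boxes
  of a union may overlap, since maxima do not notice.\<close>

definition box :: "nat \<Rightarrow> (nat \<Rightarrow> nat) \<Rightarrow> nat set \<Rightarrow> (nat \<Rightarrow>\<^sub>0 nat) set" where
  "box N c F = {u \<in> mons N. \<forall>j<N. j \<notin> F \<longrightarrow> Poly_Mapping.lookup u j = c j}"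

text \<open>Avoiding \<open>g\<close> means that some coordinate \<open>j\<close> takes one of the
  finitely many values below that of \<open>g\<close>. Each further \<open>g\<close> thus cuts a box
  into finitely many boxes with \<open>j\<close> pinned.\<close>

lemma avoiding_finite_set_eq_boxes:
  assumes "finite G"
  shows "\<exists>B. finite B \<and> {u \<in> mons N. \<forall>g\<in>G. \<exists>j<N. Poly_Mapping.lookup u j < Poly_Mapping.lookup g j} = (\<Union>(c, F)\<in>B. box N c F)"
  using assms
proof (induction G)
  case empty
  show ?case by (rule exI[of _ "{(\<lambda>_. 0, {..<N})}"]) (auto simp: box_def)
next
  case (insert g G)
  let ?D = "\<lambda>G. {u \<in> mons N. \<forall>g\<in>G. \<exists>j<N. Poly_Mapping.lookup u j < Poly_Mapping.lookup g j}"
  obtain B where B: "finite B" "?D G = (\<Union>(c, F)\<in>B. box N c F)" using insert.IH by blast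
  \<comment> \<open>The last condition demands that \<open>x\<close> agree with a value of
    \<open>j\<close> already pinned, so that every new box lies in an old one.\<close>
  let ?C = "{(b, j, x). b \<in> B \<and> j < N \<and> x < Poly_Mapping.lookup g j \<and> (j \<notin> snd b \<longrightarrow> fst b j = x)}"
  let ?h = "\<lambda>(b, j, x). ((fst b)(j := x), snd b - {j})"
  have "?C \<subseteq> B \<times> (SIGMA j:{..<N}. {..<Poly_Mapping.lookup g j})" by auto
  then have fin: "finite ?C" by (rule finite_subset) (use B(1) in auto)
  have box: "u \<in> box N (c(j := x)) (F - {j}) \<longleftrightarrow> u \<in> box N c F \<and> Poly_Mapping.lookup u j = x"
    if "j < N" "j \<notin> F \<longrightarrow> c j = x" for u c F j x
    using that by (auto simp: box_def)
  have "?D (insert g G) = (\<Union>(c, F)\<in>?h ` ?C. box N c F)"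
  proof (intro equalityI subsetI)
    fix u assume "u \<in> ?D (insert g G)"
    then obtain c F j where *: "(c, F) \<in> B" "u \<in> box N c F" "j < N" "Poly_Mapping.lookup u j < Poly_Mapping.lookup g j"
      using B(2) by blast
    then have "((c, F), j, Poly_Mapping.lookup u j) \<in> ?C" by (auto simp: box_def)
    moreover have "u \<in> box N (c(j := Poly_Mapping.lookup u j)) (F - {j})"
      using * by (auto simp: box_def)
    ultimately show "u \<in> (\<Union>(c, F)\<in>?h ` ?C. box N c F)" by force
  next
    fix u assume "u \<in> (\<Union>(c, F)\<in>?h ` ?C. box N c F)"
    then obtain c F j x where *: "((c, F), j, x) \<in> ?C" "u \<in> box N (c(j := x)) (F - {j})"
      by auto
    then have "u \<in> box N c F" "Poly_Mapping.lookup u j = x" using box[of j F c x u] by auto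
    moreover from this(1) have "u \<in> ?D G" using * B(2) by blast
    ultimately show "u \<in> ?D (insert g G)" using * by auto
  qed
  then show ?case using fin by blast
qed

text \<open>The complement is closed upwards, so by Dickson finitely many exponents \<open>G\<close>
  generate it, and \<open>D\<close> consists of the exponents avoiding \<open>G\<close>.\<close>

lemma downset_eq_boxes:
  assumes D: "D \<subseteq> mons N" and down: "\<And>u v. u \<in> mons N \<Longrightarrow> v \<in> mons N \<Longrightarrow> u + v \<in> D \<Longrightarrow> u \<in> D"
  shows "\<exists>B. finite B \<and> D = (\<Union>(c, F)\<in>B. box N c F)"
proof -
  obtain G where G: "G \<subseteq> mons N - D" "finite G" "\<forall>u\<in>mons N - D. \<exists>f\<in>G. \<exists>v\<in>mons N. u = f + v"
    using dickson[of "mons N - D" N] by auto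
  have "D = {u \<in> mons N. \<forall>g\<in>G. \<exists>j<N. Poly_Mapping.lookup u j < Poly_Mapping.lookup g j}"
  proof (intro equalityI subsetI)
    fix u assume u: "u \<in> D"
    have "\<exists>j<N. Poly_Mapping.lookup u j < Poly_Mapping.lookup g j" if "g \<in> G" for g
    proof (rule ccontr)
      assume "\<not> ?thesis"
      then have "\<forall>j<N. Poly_Mapping.lookup g j \<le> Poly_Mapping.lookup u j" by (meson not_le)
      then have "u = g + (u - g)"
        using u D G(1) that by (intro mons_le_add_diff[of _ N]) auto
      then have "g \<in> D" using down[of g "u - g"] u D G(1) that mons_diff[of u N g] by auto
      then show False using G(1) that by auto
    qed
    then show "u \<in> {u \<in> mons N. \<forall>g\<in>G. \<exists>j<N. Poly_Mapping.lookup u j < Poly_Mapping.lookup g j}" using u D by auto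
  next
    fix u assume "u \<in> {u \<in> mons N. \<forall>g\<in>G. \<exists>j<N. Poly_Mapping.lookup u j < Poly_Mapping.lookup g j}"
    then have u: "u \<in> mons N" "\<And>g. g \<in> G \<Longrightarrow> \<exists>j<N. Poly_Mapping.lookup u j < Poly_Mapping.lookup g j" by auto
    show "u \<in> D"
    proof (rule ccontr)
      assume "u \<notin> D"
      then obtain g v where "g \<in> G" "u = g + v" using G(3) u(1) by blast
      then show False using u(2)[of g] by (auto simp: lookup_add)
    qed
  qed
  then show ?thesis using avoiding_finite_set_eq_boxes[OF G(2), of N] by simp
qed

section \<open>Eventually linear maxima\<close>

text \<open>The maximum must be attained, so that the linear formula is an actual degree. Eventual
  emptiness is allowed because a piece of a union may contribute nothing for large \<open>k\<close>,
  for instance a box without free coordinates. Integer values admit negation, which turns minima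
  into maxima.\<close>

definition ev_linear_max :: "(nat \<Rightarrow> int set) \<Rightarrow> bool" where
  "ev_linear_max E \<longleftrightarrow> (\<exists>k0. \<forall>k\<ge>k0. E k = {}) \<or>
     (\<exists>a b k0. \<forall>k\<ge>k0. a * int k + b \<in> E k \<and> (\<forall>e\<in>E k. e \<le> a * int k + b))"

lemma ev_linear_max_Un:
  assumes "ev_linear_max E" "ev_linear_max E'"
  shows "ev_linear_max (\<lambda>k. E k \<union> E' k)"
proof -
  define lin where "lin E a b k0 \<longleftrightarrow> (\<forall>k\<ge>k0. a * int k + b \<in> E k \<and> (\<forall>e\<in>E k. e \<le> a * int k + b))"
    for E a b k0
  have dominated: "ev_linear_max (\<lambda>k. E k \<union> E' k)"
    if "lin E a b k0" "lin E' a' b' k1" "a < a' \<or> a = a' \<and> b \<le> b'" for E E' a b k0 a' b' k1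
  proof -
    \<comment> \<open>A slope larger by at least 1 makes up for the difference of the intercepts
      once \<open>k\<close> reaches that difference.\<close>
    have le: "a * int k + b \<le> a' * int k + b'" if "k \<ge> nat (b - b')" for k
    proof (cases "a = a'")
      case False
      then have "a + 1 \<le> a'" using \<open>a < a' \<or> a = a' \<and> b \<le> b'\<close> by auto
      then have "(a + 1) * int k \<le> a' * int k" by (rule mult_right_mono) auto
      then show ?thesis using that by (simp add: algebra_simps)
    qed (use \<open>a < a' \<or> a = a' \<and> b \<le> b'\<close> in auto)
    have "\<forall>k\<ge>max (nat (b - b')) (max k0 k1).
        a' * int k + b' \<in> E k \<union> E' k \<and> (\<forall>e\<in>E k \<union> E' k. e \<le> a' * int k + b')"
      using that(1,2) le unfolding lin_def by (fastforce intro: order_trans)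
    then show ?thesis unfolding ev_linear_max_def by blast
  qed
  have empty: "ev_linear_max (\<lambda>k. E k \<union> E' k)" if "\<forall>k\<ge>k0. E k = {}" "ev_linear_max E'" for E E' k0
    using that(2) unfolding ev_linear_max_def
  proof (elim disjE exE)
    fix k1 assume "\<forall>k\<ge>k1. E' k = {}"
    then have "\<forall>k\<ge>max k0 k1. E k \<union> E' k = {}" using that(1) by auto
    then show "(\<exists>k0. \<forall>k\<ge>k0. E k \<union> E' k = {}) \<or>
     (\<exists>a b k0. \<forall>k\<ge>k0. a * int k + b \<in> E k \<union> E' k \<and> (\<forall>e\<in>E k \<union> E' k. e \<le> a * int k + b))" by blast
  next
    fix a b k1 assume "\<forall>k\<ge>k1. a * int k + b \<in> E' k \<and> (\<forall>e\<in>E' k. e \<le> a * int k + b)"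
    then have "\<forall>k\<ge>max k0 k1. a * int k + b \<in> E k \<union> E' k \<and> (\<forall>e\<in>E k \<union> E' k. e \<le> a * int k + b)"
      using that(1) by auto
    then show "(\<exists>k0. \<forall>k\<ge>k0. E k \<union> E' k = {}) \<or>
     (\<exists>a b k0. \<forall>k\<ge>k0. a * int k + b \<in> E k \<union> E' k \<and> (\<forall>e\<in>E k \<union> E' k. e \<le> a * int k + b))" by blast
  qed
  show ?thesis
  proof (cases "(\<exists>k0. \<forall>k\<ge>k0. E k = {}) \<or> (\<exists>k0. \<forall>k\<ge>k0. E' k = {})")
    case True
    then show ?thesis
      using empty[of _ E E'] empty[of _ E' E] assms by (auto simp: Un_commute)
  next
    case False
    then obtain a b k0 a' b' k1 where "lin E a b k0" "lin E' a' b' k1"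
      using assms unfolding ev_linear_max_def lin_def by blast
    moreover have "(a < a' \<or> a = a' \<and> b \<le> b') \<or> (a' < a \<or> a' = a \<and> b' \<le> b)" by linarith
    ultimately show ?thesis
      using dominated[of E a b k0 E' a' b' k1] dominated[of E' a' b' k1 E a b k0] by (auto simp: Un_commute)
  qed
qed

lemma ev_linear_max_UN:
  assumes "finite B" "\<And>b. b \<in> B \<Longrightarrow> ev_linear_max (E b)"
  shows "ev_linear_max (\<lambda>k. \<Union>b\<in>B. E b k)"
  using assms
proof (induction B)
  case empty
  then show ?case by (auto simp: ev_linear_max_def)
next
  case (insert b B)
  then show ?case using ev_linear_max_Un[of "E b" "\<lambda>k. \<Union>b\<in>B. E b k"] by auto
qed

text \<open>The pinned coordinates contribute a constant and use up \<open>?c\<close> of the total;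
  the remaining \<open>k - ?c\<close> is best put on one free coordinate of largest weight
  \<open>m\<close>, which is therefore the slope.\<close>

lemma ev_linear_max_box:
  fixes d :: "nat \<Rightarrow> int"
  shows "ev_linear_max (\<lambda>k. {(\<Sum>i<N. d i * int (Poly_Mapping.lookup u i)) + \<delta> |u.
    u \<in> box N c F \<and> (\<Sum>i<N. Poly_Mapping.lookup u i) = k})" (is "ev_linear_max ?E")
proof -
  let ?F = "F \<inter> {..<N}" and ?C = "{..<N} - F"
  let ?c = "\<Sum>i\<in>?C. c i"
  have split: "(\<Sum>i<N. h i) = (\<Sum>i\<in>?C. h i) + (\<Sum>i\<in>?F. h i)" for h :: "nat \<Rightarrow> 'z::comm_monoid_add"
    by (subst sum.union_disjoint[symmetric]) (auto intro: sum.cong)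
  have fixed: "(\<Sum>i\<in>?C. h i (Poly_Mapping.lookup u i)) = (\<Sum>i\<in>?C. h i (c i))" if "u \<in> box N c F"
    for u and h :: "nat \<Rightarrow> nat \<Rightarrow> 'z::comm_monoid_add"
    using that by (intro sum.cong) (auto simp: box_def)
  show ?thesis
  proof (cases "?F = {}")
    case True
    have "?E k = {}" if "k \<ge> Suc ?c" for k
    proof -
      have "(\<Sum>i<N. Poly_Mapping.lookup u i) = ?c" if "u \<in> box N c F" for u
        using fixed[OF that, of "\<lambda>_ x. x"] True by (simp add: split)
      then show ?thesis using that by auto
    qed
    then show ?thesis unfolding ev_linear_max_def by blast
  next
    case False
    define m where "m = Max (d ` ?F)"
    obtain j where j: "j \<in> ?F" "d j = m"
    proof -
      have "m \<in> d ` ?F" unfolding m_def using False by (intro Max_in) auto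
      then show ?thesis using that by blast
    qed
    have dm: "d i \<le> m" if "i \<in> ?F" for i using that by (auto simp: m_def)
    define b where "b = (\<Sum>i\<in>?C. d i * int (c i)) + \<delta> - m * int ?c"
    have "m * int k + b \<in> ?E k" if k: "k \<ge> ?c" for k
    proof -
      define u where "u = (\<Sum>i\<in>?C. Poly_Mapping.single i (c i)) + Poly_Mapping.single j (k - ?c)"
      have look: "Poly_Mapping.lookup u i = (if i \<in> ?C then c i else 0) + (if i = j then k - ?c else 0)" for i
        by (simp add: u_def lookup_add lookup_sum lookup_single when_def)
      have u: "u \<in> box N c F"
        using j(1) by (auto simp: box_def mons_def in_keys_iff look split: if_splits)
      have "(\<Sum>i\<in>?F. h i (Poly_Mapping.lookup u i)) = h j (k - ?c)" if "\<And>i. h i 0 = 0"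
        for h :: "nat \<Rightarrow> nat \<Rightarrow> 'z::comm_monoid_add"
      proof -
        have "(\<Sum>i\<in>?F. h i (Poly_Mapping.lookup u i)) = (\<Sum>i\<in>?F. if i = j then h j (k - ?c) else 0)"
          using that j(1) by (intro sum.cong) (auto simp: look)
        then show ?thesis using j(1) by simp
      qed
      note F_sum = this[of "\<lambda>_ x. x"] this[of "\<lambda>i x. d i * int x"]
      have "(\<Sum>i<N. Poly_Mapping.lookup u i) = k"
        using fixed[OF u, of "\<lambda>_ x. x"] F_sum(1) k by (simp add: split)
      moreover have "(\<Sum>i<N. d i * int (Poly_Mapping.lookup u i)) + \<delta> = m * int k + b"
        using fixed[OF u, of "\<lambda>i x. d i * int x"] F_sum(2) k j(2)
        by (simp add: split b_def of_nat_diff algebra_simps)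
      ultimately show ?thesis using u by force
    qed
    moreover have "e \<le> m * int k + b" if "e \<in> ?E k" for e k
    proof -
      obtain u where u: "u \<in> box N c F" "(\<Sum>i<N. Poly_Mapping.lookup u i) = k"
        and e: "e = (\<Sum>i<N. d i * int (Poly_Mapping.lookup u i)) + \<delta>"
        using \<open>e \<in> ?E k\<close> by auto
      have "(\<Sum>i\<in>?F. d i * int (Poly_Mapping.lookup u i)) \<le> (\<Sum>i\<in>?F. m * int (Poly_Mapping.lookup u i))"
        by (intro sum_mono mult_right_mono dm) auto
      also have "\<dots> = m * int (\<Sum>i\<in>?F. Poly_Mapping.lookup u i)" by (simp add: sum_distrib_left)
      also have "int (\<Sum>i\<in>?F. Poly_Mapping.lookup u i) = int k - int ?c"
        using u(2) fixed[OF u(1), of "\<lambda>_ x. x"] unfolding split by linarith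
      finally show ?thesis
        using fixed[OF u(1), of "\<lambda>i x. d i * int x"] by (simp add: e split b_def algebra_simps)
    qed
    ultimately show ?thesis unfolding ev_linear_max_def by blast
  qed
qed

lemma ev_linear_max_downset:
  fixes d \<delta> :: "nat \<Rightarrow> int" and D :: "(nat \<times> (nat \<Rightarrow>\<^sub>0 nat)) set"
  assumes D: "D \<subseteq> {..<s} \<times> mons N"
    and down: "\<And>j u v. u \<in> mons N \<Longrightarrow> v \<in> mons N \<Longrightarrow> (j, u + v) \<in> D \<Longrightarrow> (j, u) \<in> D"
  shows "ev_linear_max (\<lambda>k. {(\<Sum>i<N. d i * int (Poly_Mapping.lookup u i)) + \<delta> j |j u.
    (j, u) \<in> D \<and> (\<Sum>i<N. Poly_Mapping.lookup u i) = k})"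
proof -
  let ?E = "\<lambda>j X k. {(\<Sum>i<N. d i * int (Poly_Mapping.lookup u i)) + \<delta> j |u.
    u \<in> X \<and> (\<Sum>i<N. Poly_Mapping.lookup u i) = k}"
  have "ev_linear_max (?E j {u. (j, u) \<in> D})" for j
  proof -
    obtain B where B: "finite B" "{u. (j, u) \<in> D} = (\<Union>(c, F)\<in>B. box N c F)"
    proof -
      have "\<exists>B. finite B \<and> {u. (j, u) \<in> D} = (\<Union>(c, F)\<in>B. box N c F)"
        by (rule downset_eq_boxes) (use D down in auto)
      then show ?thesis using that by metis
    qed
    have "ev_linear_max (\<lambda>k. \<Union>b\<in>B. ?E j (box N (fst b) (snd b)) k)"
      using B(1) ev_linear_max_box by (rule ev_linear_max_UN)
    also have "(\<lambda>k. \<Union>b\<in>B. ?E j (box N (fst b) (snd b)) k) = ?E j {u. (j, u) \<in> D}"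
      unfolding B(2) by (intro ext) (auto simp: split_beta)
    finally show ?thesis .
  qed
  then have "ev_linear_max (\<lambda>k. \<Union>j\<in>{..<s}. ?E j {u. (j, u) \<in> D} k)"
    by (intro ev_linear_max_UN) auto
  also have "(\<lambda>k. \<Union>j\<in>{..<s}. ?E j {u. (j, u) \<in> D} k) = (\<lambda>k. {(\<Sum>i<N. d i * int (Poly_Mapping.lookup u i)) + \<delta> j |j u.
    (j, u) \<in> D \<and> (\<Sum>i<N. Poly_Mapping.lookup u i) = k})"
    using D by (intro ext) blast
  finally show ?thesis .
qed

section \<open>Standard monomials\<close>

text \<open>K-spans are the right closure for reductions: a scalar changes neither the index of a
  product nor its grade.\<close>

global_interpretation kv: module
  "\<lambda>c (p :: ('n::finite, 'k::field) mpoly). Poly_Mapping.single 0 c * p"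
  by standard (simp_all add: distrib_left distrib_right single_add mult_single flip: mult.assoc)

lemma subspace_is_ideal: "is_ideal J \<Longrightarrow> kv.subspace J"
  using is_idealD[of J] by (auto simp: kv.subspace_def)

lemma mult_kv_span:
  assumes "x \<in> kv.span A" "\<And>a. a \<in> A \<Longrightarrow> p * a \<in> V" "kv.subspace V"
  shows "p * x \<in> V"
  using assms(1)
proof (induction rule: kv.span_induct_alt)
  case base
  then show ?case using kv.subspace_0[OF assms(3)] by simp
next
  case (step c a y)
  have "p * (Poly_Mapping.single 0 c * a + y) = Poly_Mapping.single 0 c * (p * a) + p * y"
    by (simp add: algebra_simps)
  then show ?case
    using step assms by (metis kv.subspace_add kv.subspace_scale)
qed

text \<open>A combination involves finitely many indices, hence a largest one, which serves as a
  leading index in inductions. It is not determined by \<open>x\<close>, since the family may be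
  dependent.\<close>

lemma kv_span_principal:
  fixes w :: "'i::linorder \<Rightarrow> ('n::finite, 'k::field) mpoly"
  assumes "x \<in> kv.span (w ` X)"
  shows "x = 0 \<or> (\<exists>q\<in>X. x \<in> kv.span (w ` {q'\<in>X. q' \<le> q}))"
  using assms
proof (induction rule: kv.span_induct_alt)
  case base
  then show ?case by simp
next
  case (step c a y)
  then obtain r where r: "r \<in> X" "a = w r" by auto
  have ex: "\<exists>q\<in>X. r \<le> q \<and> y \<in> kv.span (w ` {q'\<in>X. q' \<le> q})"
    using step(2)
  proof (elim disjE bexE)
    assume "y = 0" then show ?thesis using r kv.span_zero by auto
  next
    fix q assume q: "q \<in> X" "y \<in> kv.span (w ` {q'\<in>X. q' \<le> q})"
    have "kv.span (w ` {q'\<in>X. q' \<le> q}) \<subseteq> kv.span (w ` {q'\<in>X. q' \<le> max q r})"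
      by (intro kv.span_mono image_mono) (auto simp: le_max_iff_disj)
    then show ?thesis using q r by (intro bexI[of _ "max q r"]) (auto simp: max_def)
  qed
  then obtain q where q: "q \<in> X" "r \<le> q" "y \<in> kv.span (w ` {q'\<in>X. q' \<le> q})" by blast
  then have "a \<in> kv.span (w ` {q'\<in>X. q' \<le> q})" using r by (intro kv.span_base) auto
  then show ?case using q by (intro disjI2 bexI[of _ q] kv.span_add kv.span_scale) auto
qed

text \<open>The products of powers of the \<open>g i\<close> with an \<open>e j\<close> imitate the
  monomials of a free module over a polynomial ring whose indeterminates have weights
  \<open>\<kappa> i\<close>, and \<open>J\<close> takes the place of a graded submodule. No
  independence of the products is assumed.\<close>

locale standard_monomials =
  fixes N s :: nat and g :: "nat \<Rightarrow> ('n::finite, 'k::field) mpoly" and \<kappa> :: "nat \<Rightarrow> nat"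
    and e :: "nat \<Rightarrow> ('n, 'k) mpoly" and J :: "nat \<Rightarrow> ('n, 'k) mpoly set"
  assumes J_subspace: "kv.subspace (J k)"
    and J_mult: "i < N \<Longrightarrow> x \<in> J k \<Longrightarrow> g i * x \<in> J (k + \<kappa> i)"
begin

definition mon :: "(nat \<Rightarrow>\<^sub>0 nat) \<Rightarrow> ('n, 'k) mpoly" where
  "mon u = (\<Prod>i<N. g i ^ Poly_Mapping.lookup u i)"

definition grade :: "(nat \<Rightarrow>\<^sub>0 nat) \<Rightarrow> nat" where
  "grade u = (\<Sum>i<N. \<kappa> i * Poly_Mapping.lookup u i)"

definition ind :: "nat \<Rightarrow> (nat \<times> (nat \<Rightarrow>\<^sub>0 nat)) set" where
  "ind k = {(j, u). j < s \<and> u \<in> mons N \<and> grade u = k}"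

definition emon :: "nat \<times> (nat \<Rightarrow>\<^sub>0 nat) \<Rightarrow> ('n, 'k) mpoly" where
  "emon q = mon (snd q) * e (fst q)"

definition below :: "nat \<Rightarrow> nat \<times> (nat \<Rightarrow>\<^sub>0 nat) \<Rightarrow> ('n, 'k) mpoly set" where
  "below k p = kv.span (emon ` {q \<in> ind k. q < p})"

text \<open>In the free module on the symbols \<open>(j, u)\<close> these are the leading symbols of
  the combinations that map into \<open>J\<close>. Relations among the products themselves are
  included, since 0 lies in \<open>J\<close>.\<close>

definition nonstd :: "(nat \<times> (nat \<Rightarrow>\<^sub>0 nat)) set" where
  "nonstd = {(j, u). j < s \<and> u \<in> mons N \<and> (\<exists>z\<in>J (grade u). emon (j, u) - z \<in> below (grade u) (j, u))}"

lemma mon_add: "mon (u + v) = mon u * mon v"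
  by (simp add: mon_def lookup_add power_add prod.distrib)

lemma grade_add: "grade (u + v) = grade u + grade v"
  by (simp add: grade_def lookup_add distrib_left sum.distrib)

lemma mon_zero [simp]: "mon 0 = 1"
  by (simp add: mon_def)

lemma grade_zero [simp]: "grade 0 = 0"
  by (simp add: grade_def)

lemma mon_single: "i < N \<Longrightarrow> mon (Poly_Mapping.single i 1) = g i"
proof -
  assume i: "i < N"
  have "mon (Poly_Mapping.single i 1) = (\<Prod>j<N. if j = i then g i else 1)"
    unfolding mon_def by (intro prod.cong) (auto simp: lookup_single when_def)
  then show ?thesis using i by simp
qed

lemma grade_single: "i < N \<Longrightarrow> grade (Poly_Mapping.single i 1) = \<kappa> i"
proof -
  assume i: "i < N"
  have "grade (Poly_Mapping.single i 1) = (\<Sum>j<N. if j = i then \<kappa> i else 0)"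
    unfolding grade_def by (intro sum.cong) (auto simp: lookup_single when_def)
  then show ?thesis using i by simp
qed

lemma mon_mult_J: "x \<in> J k \<Longrightarrow> mon u * x \<in> J (k + grade u)"
proof -
  assume x: "x \<in> J k"
  have pow: "g i ^ m * y \<in> J (l + \<kappa> i * m)" if "i < N" "y \<in> J l" for i m y l
  proof (induction m)
    case 0
    then show ?case using that by simp
  next
    case (Suc m)
    then show ?case using J_mult[OF that(1) Suc] by (simp add: algebra_simps)
  qed
  have "(\<Prod>i<n. g i ^ Poly_Mapping.lookup u i) * x \<in> J (k + (\<Sum>i<n. \<kappa> i * Poly_Mapping.lookup u i))"
    if "n \<le> N" for n
    using that
  proof (induction n)
    case 0
    then show ?case using x by simp
  next
    case (Suc n)
    then show ?case using pow[of n "(\<Prod>i<n. g i ^ Poly_Mapping.lookup u i) * x" "k + (\<Sum>i<n. \<kappa> i * Poly_Mapping.lookup u i)" "Poly_Mapping.lookup u n"]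
      by (simp add: mult_ac add_ac)
  qed
  from this[of N] show ?thesis by (simp add: mon_def grade_def)
qed

lemma mon_mult_below:
  assumes "v \<in> mons N" "x \<in> below k (j, u)"
  shows "mon v * x \<in> below (k + grade v) (j, u + v)"
  using assms(2) unfolding below_def
proof (rule mult_kv_span)
  fix a assume "a \<in> emon ` {q \<in> ind k. q < (j, u)}"
  then obtain i t where a: "a = emon (i, t)" "(i, t) \<in> ind k" "(i, t) < (j, u)" by auto
  have "(i, t + v) \<in> ind (k + grade v)"
    using a(2) assms(1) by (auto simp: ind_def grade_add mons_add)
  moreover have "(i, t + v) < (j, u + v)"
    using a(3) by auto
  moreover have "mon v * a = emon (i, t + v)"
    by (simp add: a(1) emon_def mon_add mult_ac)
  ultimately show "mon v * a \<in> kv.span (emon ` {q \<in> ind (k + grade v). q < (j, u + v)})"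
    by (intro kv.span_base) auto
qed simp

text \<open>Multiplying a relation by \<open>mon v\<close> shifts its leading symbol by
  \<open>v\<close>, as the order respects addition. So Dickson applies to the nonstandard symbols,
  and the standard ones are closed under division.\<close>

lemma nonstd_add:
  assumes "(j, u) \<in> nonstd" "v \<in> mons N"
  shows "(j, u + v) \<in> nonstd"
proof -
  obtain z where z: "j < s" "u \<in> mons N" "z \<in> J (grade u)" "emon (j, u) - z \<in> below (grade u) (j, u)"
    using assms(1) by (auto simp: nonstd_def)
  have "mon v * (emon (j, u) - z) = emon (j, u + v) - mon v * z"
    by (simp add: emon_def mon_add algebra_simps)
  then have "emon (j, u + v) - mon v * z \<in> below (grade (u + v)) (j, u + v)"
    using mon_mult_below[OF assms(2) z(4)] by (simp add: grade_add)
  moreover have "mon v * z \<in> J (grade (u + v))"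
    using mon_mult_J[OF z(3), of v] by (simp add: grade_add)
  ultimately show ?thesis using z(1,2) assms(2) by (auto simp: nonstd_def mons_add)
qed

lemma wf_ind: "wf {(p, q). p \<in> {..<s} \<times> mons N \<and> q \<in> {..<s} \<times> mons N \<and> p < q}"
proof (rule wf_subset)
  show "wf (less_than <*lex*> {(u, v). u \<in> mons N \<and> v \<in> mons N \<and> u < v})"
    by (intro wf_lex_prod wf_less_than wf_mons)
qed (auto simp: less_prod_def')

lemma ind_induct [consumes 1, case_names less]:
  assumes "q \<in> ind k" "\<And>q. q \<in> ind k \<Longrightarrow> (\<And>p. p \<in> ind k \<Longrightarrow> p < q \<Longrightarrow> Q p) \<Longrightarrow> Q q"
  shows "Q q"
  using assms(1)
proof (induction q rule: wf_induct_rule[OF wf_ind])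
  case (1 q)
  show ?case
  proof (rule assms(2)[OF 1(2)])
    fix p assume "p \<in> ind k" "p < q"
    then show "Q p" using 1 by (auto simp: ind_def)
  qed
qed

text \<open>The spanning half of Macaulay's basis theorem: a nonstandard product is an element of
  \<open>J\<close> plus a combination of smaller products of the same grade, and well-foundedness
  ends the rewriting.\<close>

lemma span_std_reduction:
  "kv.span (emon ` ind k) \<subseteq> {y + z | y z. y \<in> kv.span (emon ` (ind k - nonstd)) \<and> z \<in> J k}"
proof -
  let ?T = "kv.span (emon ` (ind k - nonstd) \<union> J k)"
  have J: "J k \<subseteq> ?T" by (auto intro: kv.span_base)
  have "emon q \<in> ?T" if "q \<in> ind k" for q
    using that
  proof (induction q rule: ind_induct)
    case (less q)
    show ?case
    proof (cases "q \<in> nonstd")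
      case False
      then show ?thesis using less(1) by (intro kv.span_base) auto
    next
      case True
      then obtain z where z: "z \<in> J k" "emon q - z \<in> below k q"
        using less(1) by (auto simp: nonstd_def ind_def)
      have "below k q \<subseteq> ?T"
        unfolding below_def using less by (intro kv.span_minimal) auto
      then have "(emon q - z) + z \<in> ?T" using z J by (intro kv.span_add) auto
      then show ?thesis by simp
    qed
  qed
  then have "kv.span (emon ` ind k) \<subseteq> ?T" by (intro kv.span_minimal) auto
  also have "?T = {y + z | y z. y \<in> kv.span (emon ` (ind k - nonstd)) \<and> z \<in> J k}"
  proof -
    have eq: "kv.span (J k) = J k" using J_subspace[of k] kv.span_eq_iff by blast
    show ?thesis unfolding kv.span_Un eq ..
  qed
  finally show ?thesis .
qed

lemma emon_std_notin_J: "q \<in> ind k \<Longrightarrow> q \<notin> nonstd \<Longrightarrow> emon q \<notin> J k"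
  by (auto simp: nonstd_def ind_def below_def intro!: kv.span_zero bexI[of _ "emon q"])

text \<open>A Groebner basis argument. Dickson yields finitely many minimal nonstandard symbols; for
  each an element of \<open>J\<close> with this leading symbol is chosen, and division by these
  elements leaves no remainder on \<open>J\<close>. Intersecting with the span provides a leading
  symbol to start from.\<close>

lemma J_finitely_generated:
  "\<exists>B. finite B \<and> (\<forall>(k, b)\<in>B. b \<in> J k) \<and>
     (\<forall>k. J k \<inter> kv.span (emon ` ind k) \<subseteq> kv.span {mon u * b | u l b. (l, b) \<in> B \<and> u \<in> mons N \<and> grade u + l = k})"
proof -
  have "\<exists>F\<subseteq>{u. (j, u) \<in> nonstd}. finite F \<and> (\<forall>u\<in>{u. (j, u) \<in> nonstd}. \<exists>f\<in>F. \<exists>v\<in>mons N. u = f + v)" for j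
    by (rule dickson) (auto simp: nonstd_def)
  then obtain F where F: "\<And>j. F j \<subseteq> {u. (j, u) \<in> nonstd}" "\<And>j. finite (F j)"
    "\<And>j. \<forall>u\<in>{u. (j, u) \<in> nonstd}. \<exists>f\<in>F j. \<exists>v\<in>mons N. u = f + v"
    by metis
  have "\<exists>z. z \<in> J (grade (snd q)) \<and> emon q - z \<in> below (grade (snd q)) q" if "q \<in> nonstd" for q
    using that by (auto simp: nonstd_def)
  \<comment> \<open>\<open>\<zeta> q\<close> is an element of \<open>J\<close> that agrees with
    \<open>emon q\<close> up to smaller products: monic with leading symbol
    \<open>q\<close>.\<close>
  then obtain \<zeta> where \<zeta>: "\<And>q. q \<in> nonstd \<Longrightarrow> \<zeta> q \<in> J (grade (snd q))"
    "\<And>q. q \<in> nonstd \<Longrightarrow> emon q - \<zeta> q \<in> below (grade (snd q)) q"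
    by metis
  let ?Q = "SIGMA j:{..<s}. F j"
  define B where "B = (\<lambda>q. (grade (snd q), \<zeta> q)) ` ?Q"
  have Q: "?Q \<subseteq> nonstd" using F(1) by auto
  define R where "R k = kv.span {mon u * b | u l b. (l, b) \<in> B \<and> u \<in> mons N \<and> grade u + l = k}" for k
  have lower: "x \<in> R k" if "x \<in> J k" "x \<in> kv.span (emon ` {p \<in> ind k. p \<le> q})" "q \<in> ind k" for x q k
    using that(3,1,2)
  proof (induction q arbitrary: x rule: ind_induct)
    case (less q)
    \<comment> \<open>An element of \<open>below k q\<close> has a largest index
      \<open>p < q\<close> of its own, to which the induction hypothesis applies.\<close>
    have below_R: "y \<in> R k" if "y \<in> J k" "y \<in> below k q" for y
    proof -
      have "y = 0 \<or> (\<exists>p\<in>{p \<in> ind k. p < q}. y \<in> kv.span (emon ` {p'\<in>{p \<in> ind k. p < q}. p' \<le> p}))"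
        using that(2) unfolding below_def by (rule kv_span_principal)
      then show ?thesis
      proof (elim disjE bexE)
        assume "y = 0" then show ?thesis by (simp add: R_def kv.span_zero)
      next
        fix p assume p: "p \<in> {p \<in> ind k. p < q}" "y \<in> kv.span (emon ` {p'\<in>{p \<in> ind k. p < q}. p' \<le> p})"
        have "y \<in> kv.span (emon ` {p' \<in> ind k. p' \<le> p})"
          using p(2) by (rule subsetD[OF kv.span_mono, rotated]) auto
        then show ?thesis using less.IH[of p y] p(1) that(1) by auto
      qed
    qed
    have "{p \<in> ind k. p \<le> q} = insert q {p \<in> ind k. p < q}" using less.hyps by auto
    then obtain c where c: "x - Poly_Mapping.single 0 c * emon q \<in> below k q"
      using less.prems(2) by (auto simp: below_def kv.span_insert)
    show ?case
    proof (cases "c = 0")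
      case True
      then show ?thesis using c less.prems(1) below_R by simp
    next
      case False
      obtain j u where q: "q = (j, u)" "j < s" "u \<in> mons N" "grade u = k"
        using less.hyps by (auto simp: ind_def)
      \<comment> \<open>Normalising the leading coefficient exhibits \<open>inverse c\<close> times
        \<open>x\<close>, an element of \<open>J\<close>, with leading symbol \<open>q\<close>;
        hence \<open>q\<close> is nonstandard.\<close>
      have "Poly_Mapping.single 0 (- inverse c) * (x - Poly_Mapping.single 0 c * emon q) = emon q - Poly_Mapping.single 0 (inverse c) * x"
        using False by (simp add: right_diff_distrib mult_single single_uminus flip: mult.assoc)
      then have "emon q - Poly_Mapping.single 0 (inverse c) * x \<in> below k q"
        using kv.span_scale[OF c[unfolded below_def], of "- inverse c"] by (simp add: below_def)
      moreover have "Poly_Mapping.single 0 (inverse c) * x \<in> J k"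
        by (rule kv.subspace_scale[OF J_subspace less.prems(1)])
      ultimately have "(j, u) \<in> nonstd"
        using q by (auto simp: nonstd_def)
      then obtain f v where f: "f \<in> F j" "v \<in> mons N" "u = f + v" using F(3) by blast
      have jf: "(j, f) \<in> ?Q" using f(1) q(2) by auto
      then have nf: "(j, f) \<in> nonstd" using Q by blast
      let ?b = "\<zeta> (j, f)"
      have k: "grade f + grade v = k" using f(3) q(4) by (simp add: grade_add)
      have "(grade f, ?b) \<in> B" unfolding B_def by (rule image_eqI[OF _ jf]) simp
      then have R: "mon v * ?b \<in> R k"
        unfolding R_def using f(2) k by (intro kv.span_base) (auto simp: add.commute)
      have "mon v * (emon (j, f) - ?b) \<in> below k q"
        using mon_mult_below[OF f(2) \<zeta>(2)[OF nf, simplified]] k f(3) q(1) by simp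
      then have "emon q - mon v * ?b \<in> below k q"
        by (simp add: q(1) f(3) emon_def mon_add algebra_simps)
      \<comment> \<open>The division step: subtracting \<open>c\<close> times a multiple of the
        chosen generator cancels the leading product without leaving \<open>J\<close>.\<close>
      then have "(x - Poly_Mapping.single 0 c * emon q) + Poly_Mapping.single 0 c * (emon q - mon v * ?b) \<in> below k q"
        using c unfolding below_def by (intro kv.span_add kv.span_scale)
      then have "x - Poly_Mapping.single 0 c * (mon v * ?b) \<in> below k q"
        by (simp add: algebra_simps)
      moreover have "x - Poly_Mapping.single 0 c * (mon v * ?b) \<in> J k"
        using mon_mult_J[OF \<zeta>(1)[OF nf], of v] less.prems(1) k
        by (intro kv.subspace_diff kv.subspace_scale J_subspace) auto
      ultimately have "x - Poly_Mapping.single 0 c * (mon v * ?b) \<in> R k" by (intro below_R)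
      then have "(x - Poly_Mapping.single 0 c * (mon v * ?b)) + Poly_Mapping.single 0 c * (mon v * ?b) \<in> R k"
        using R unfolding R_def by (intro kv.span_add kv.span_scale)
      then show ?thesis by simp
    qed
  qed
  have "J k \<inter> kv.span (emon ` ind k) \<subseteq> R k" for k
  proof
    fix x assume x: "x \<in> J k \<inter> kv.span (emon ` ind k)"
    then have "x = 0 \<or> (\<exists>q\<in>ind k. x \<in> kv.span (emon ` {p \<in> ind k. p \<le> q}))"
      by (intro kv_span_principal) auto
    then show "x \<in> R k"
    proof (elim disjE bexE)
      assume "x = 0" then show ?thesis by (simp add: R_def kv.span_zero)
    qed (use x lower in auto)
  qed
  moreover have "finite B" unfolding B_def using F(2) by auto
  moreover have "\<forall>(k, b)\<in>B. b \<in> J k" unfolding B_def using \<zeta>(1) Q by auto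
  ultimately show ?thesis unfolding R_def by blast
qed

end

section \<open>Noetherian properties of the Rees algebra\<close>

lemma ideal_pow_mult_family:
  assumes J: "\<And>k. is_ideal (J k)" "\<And>k a x. a \<in> I \<Longrightarrow> x \<in> J k \<Longrightarrow> a * x \<in> J (Suc k)"
    and "c \<in> ideal_pow I m" "x \<in> J k"
  shows "c * x \<in> J (k + m)"
  using assms(3)
proof (induction m arbitrary: c)
  case 0
  then show ?case using assms(4) is_idealD(3)[OF J(1)] by simp
next
  case (Suc m)
  let ?L = "{c. \<forall>y\<in>{x}. c * y \<in> J (k + Suc m)}"
  have "ideal_prod I (ideal_pow I m) \<subseteq> ?L"
    using J(2) Suc.IH by (intro ideal_prod_least is_ideal_conductor J(1)) (auto simp: mult.assoc)
  then show ?case using Suc.prems by auto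
qed

text \<open>Finite generation of a homogeneous ideal of the Rees algebra, with \<open>J k\<close> as
  its part of degree \<open>k\<close> and \<open>B\<close> as generators tagged by degree. By
  \<open>J_pow\<close> the family lies in the Rees algebra, so each element of \<open>J k\<close> is
  a combination of products.\<close>

lemma rees_finitely_generated:
  fixes f :: "nat \<Rightarrow> ('n::finite, 'k::field) mpoly"
  assumes I: "I = ideal_gen (f ` {..<r})"
    and J: "\<And>k. is_ideal (J k)" "\<And>k a x. a \<in> I \<Longrightarrow> x \<in> J k \<Longrightarrow> a * x \<in> J (Suc k)"
    and J_pow: "\<And>k. J k \<subseteq> ideal_pow I k"
  shows "\<exists>B. finite B \<and> (\<forall>(k, b)\<in>B. b \<in> J k) \<and>
    (\<forall>k. J k \<subseteq> ideal_gen {c * b | c l b. (l, b) \<in> B \<and> l \<le> k \<and> c \<in> ideal_pow I (k - l)})"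
proof -
  define n where "n = card (UNIV :: 'n set)"
  have "\<exists>idx. bij_betw idx (UNIV :: 'n set) {..<n}"
    by (rule finite_same_card_bij) (simp_all add: n_def)
  then obtain idx :: "'n \<Rightarrow> nat" where idx: "bij_betw idx UNIV {..<n}" ..
  define en where "en = inv_into UNIV idx"
  have en: "en (idx i) = i" "idx i < n" for i
    using idx by (auto simp: en_def bij_betw_def)
  \<comment> \<open>The Rees algebra is generated over K by the variables in weight 0 and the
    generators of \<open>I\<close> in weight 1; as a module over itself it needs the single
    generator 1.\<close>
  define g where "g i = (if i < n then var (en i) else f (i - n))" for i
  define \<kappa> :: "nat \<Rightarrow> nat" where "\<kappa> i = (if i < n then 0 else 1)" for i
  have f: "f j \<in> I" if "j < r" for j
    unfolding I using that by (intro subsetD[OF ideal_gen_superset]) auto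
  have g_mult: "g i * x \<in> L (k + \<kappa> i)"
    if "\<And>k. is_ideal (L k)" "\<And>k a x. a \<in> I \<Longrightarrow> x \<in> L k \<Longrightarrow> a * x \<in> L (Suc k)" "i < n + r" "x \<in> L k"
    for L i x k
    using that f by (auto simp: g_def \<kappa>_def intro: is_idealD(3)[OF that(1)])
  interpret J: standard_monomials "n + r" "Suc 0" g \<kappa> "\<lambda>_. 1" J
    by unfold_locales (auto intro: subspace_is_ideal J g_mult)
  \<comment> \<open>The powers of \<open>I\<close> obey the same closure rules, so a product of
    grade \<open>k\<close> lies in \<open>I^k\<close>.\<close>
  interpret Pow: standard_monomials "n + r" "Suc 0" g \<kappa> "\<lambda>_. 1" "ideal_pow I"
    by unfold_locales (auto intro!: subspace_is_ideal is_ideal_ideal_pow g_mult[of "ideal_pow I"] intro: ideal_prodI)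
  have mon: "J.mon u \<in> ideal_pow I (J.grade u)" for u
    using Pow.mon_mult_J[of 1 0 u] by simp
  \<comment> \<open>The converse direction: these spans are ideals, since the variables are among
    the multipliers, and therefore contain \<open>I^k\<close>.\<close>
  define V where "V k = kv.span (J.emon ` J.ind k)" for k
  have gV: "g i * x \<in> V (k + \<kappa> i)" if "i < n + r" "x \<in> V k" for i x k
    using that(2) unfolding V_def
  proof (rule mult_kv_span)
    fix a assume "a \<in> J.emon ` J.ind k"
    then obtain j u where a: "a = J.emon (j, u)" "(j, u) \<in> J.ind k" by auto
    let ?u = "u + Poly_Mapping.single i 1"
    have "g i * a = J.emon (j, ?u)"
      using J.mon_single[OF that(1)] by (simp add: a(1) J.emon_def J.mon_add mult_ac)
    moreover have "(j, ?u) \<in> J.ind (k + \<kappa> i)"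
      using a(2) that(1) J.grade_single[OF that(1)]
      by (auto simp: J.ind_def J.grade_add intro!: mons_add mons_single)
    ultimately show "g i * a \<in> kv.span (J.emon ` J.ind (k + \<kappa> i))"
      by (auto intro: kv.span_base)
  qed simp
  have V_ideal: "is_ideal (V k)" for k
  proof (rule is_ideal_mpolyI)
    fix i x assume "x \<in> V k"
    then show "var i * x \<in> V k"
      using gV[of "idx i" x k] en[of i] by (simp add: g_def \<kappa>_def)
  qed (auto simp: V_def intro: kv.span_zero kv.span_add kv.span_scale)
  have "J.emon (0, 0) \<in> V 0"
    unfolding V_def by (intro kv.span_base imageI) (simp add: J.ind_def mons_zero)
  then have "1 \<in> V 0" by (simp add: J.emon_def)
  then have V0: "V 0 = UNIV" using is_idealD(3)[OF V_ideal, of 1 0] by auto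
  have pow_V: "ideal_pow I k \<subseteq> V k" for k
  proof (induction k)
    case (Suc k)
    have "I \<subseteq> {a. \<forall>b\<in>V k. a * b \<in> V (Suc k)}"
      unfolding I
    proof (intro ideal_gen_least is_ideal_conductor V_ideal subsetI)
      fix a assume "a \<in> f ` {..<r}"
      then obtain j where j: "j < r" "a = f j" by auto
      then have "g (n + j) = a" "\<kappa> (n + j) = 1" by (auto simp: g_def \<kappa>_def)
      then show "a \<in> {a. \<forall>b\<in>V k. a * b \<in> V (Suc k)}" using gV[of "n + j" _ k] j by auto
    qed
    then have "ideal_prod I (ideal_pow I k) \<subseteq> V (Suc k)"
      using Suc by (intro ideal_prod_least V_ideal) blast
    then show ?case by simp
  qed (simp add: V0)
  obtain B where B: "finite B" "\<forall>(k, b)\<in>B. b \<in> J k"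
    "\<And>k. J k \<inter> V k \<subseteq> kv.span {J.mon u * b | u l b. (l, b) \<in> B \<and> u \<in> mons (n + r) \<and> J.grade u + l = k}"
    using J.J_finitely_generated unfolding V_def by blast
  have "J k \<subseteq> ideal_gen {c * b | c l b. (l, b) \<in> B \<and> l \<le> k \<and> c \<in> ideal_pow I (k - l)}" for k
  proof -
    have "J k \<subseteq> J k \<inter> V k" using J_pow[of k] pow_V[of k] by auto
    also have "\<dots> \<subseteq> kv.span {J.mon u * b | u l b. (l, b) \<in> B \<and> u \<in> mons (n + r) \<and> J.grade u + l = k}"
      by (rule B(3))
    also have "\<dots> \<subseteq> ideal_gen {c * b | c l b. (l, b) \<in> B \<and> l \<le> k \<and> c \<in> ideal_pow I (k - l)}"
    proof (intro kv.span_minimal subspace_is_ideal is_ideal_ideal_gen subsetI)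
      fix x assume "x \<in> {J.mon u * b | u l b. (l, b) \<in> B \<and> u \<in> mons (n + r) \<and> J.grade u + l = k}"
      then obtain u l b where x: "x = J.mon u * b" "(l, b) \<in> B" "J.grade u + l = k" by auto
      have "l \<le> k" "J.mon u \<in> ideal_pow I (k - l)" using mon[of u] x(3) by auto
      then show "x \<in> ideal_gen {c * b | c l b. (l, b) \<in> B \<and> l \<le> k \<and> c \<in> ideal_pow I (k - l)}"
        using x(1,2) by (intro subsetD[OF ideal_gen_superset]) blast
    qed
    finally show ?thesis .
  qed
  then show ?thesis using B(1,2) by (intro exI[of _ B]) auto
qed

text \<open>Above the largest tag \<open>k0\<close> of a generator, every coefficient in degree
  \<open>k + 1\<close> lies in a positive power of \<open>I\<close>. One factor from
  \<open>I\<close> splits off, and what remains still sends the generator into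
  \<open>J k\<close>.\<close>

lemma rees_stable:
  fixes f :: "nat \<Rightarrow> ('n::finite, 'k::field) mpoly"
  assumes I: "I = ideal_gen (f ` {..<r})"
    and J: "\<And>k. is_ideal (J k)" "\<And>k a x. a \<in> I \<Longrightarrow> x \<in> J k \<Longrightarrow> a * x \<in> J (Suc k)"
    and J_pow: "\<And>k. J k \<subseteq> ideal_pow I k"
  shows "\<exists>k0. \<forall>k\<ge>k0. J (Suc k) \<subseteq> ideal_prod I (J k)"
proof -
  obtain B where B: "finite B" "\<forall>(k, b)\<in>B. b \<in> J k"
    "\<forall>k. J k \<subseteq> ideal_gen {c * b | c l b. (l, b) \<in> B \<and> l \<le> k \<and> c \<in> ideal_pow I (k - l)}"
    using rees_finitely_generated[of I f r J] assms by auto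
  define k0 where "k0 = Max (insert 0 (fst ` B))"
  have k0: "l \<le> k0" if "(l, b) \<in> B" for l b
    unfolding k0_def using that B(1) by (intro Max_ge) force+
  have "J (Suc k) \<subseteq> ideal_prod I (J k)" if "k \<ge> k0" for k
  proof -
    have "c * b \<in> ideal_prod I (J k)" if "(l, b) \<in> B" "c \<in> ideal_pow I (Suc k - l)" for c l b
    proof -
      have l: "l \<le> k" using k0[OF that(1)] \<open>k \<ge> k0\<close> by simp
      have "d * b \<in> J k" if "d \<in> ideal_pow I (k - l)" for d
        using ideal_pow_mult_family[of J I d "k - l" b l] J B(2) \<open>(l, b) \<in> B\<close> that l by auto
      then have "ideal_prod I (ideal_pow I (k - l)) \<subseteq> {c. \<forall>y\<in>{b}. c * y \<in> ideal_prod I (J k)}"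
        by (intro ideal_prod_least is_ideal_conductor is_ideal_ideal_prod)
          (auto simp: mult.assoc intro: ideal_prodI)
      then show ?thesis using that(2) l by (auto simp: Suc_diff_le)
    qed
    then have "ideal_gen {c * b | c l b. (l, b) \<in> B \<and> l \<le> Suc k \<and> c \<in> ideal_pow I (Suc k - l)}
        \<subseteq> ideal_prod I (J k)"
      by (intro ideal_gen_least is_ideal_ideal_prod) auto
    then show ?thesis using B(3) by blast
  qed
  then show ?thesis by blast
qed

text \<open>The Rees algebra of the zero ideal is \<open>S\<close> in degree 0, so \<open>L\<close>
  is the degree 0 part of a family that vanishes above.\<close>

lemma hilbert_basis:
  fixes L :: "('n::finite, 'k::field) mpoly set"
  assumes "is_ideal L"
  shows "\<exists>A. finite A \<and> L = ideal_gen A"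
proof -
  have zero: "is_ideal ({0} :: ('n, 'k) mpoly set)" by (simp add: is_ideal_def)
  define J where "J k = (if k = 0 then L else {0})" for k :: nat
  have I: "ideal_gen ((\<lambda>_. 0) ` {..<0::nat}) = ({0} :: ('n, 'k) mpoly set)"
    using ideal_gen_least[OF zero, of "{}"] is_idealD(1)[OF is_ideal_ideal_gen, of "{} :: ('n, 'k) mpoly set"]
    by auto
  have "\<exists>B. finite B \<and> (\<forall>(k, b)\<in>B. b \<in> J k) \<and>
    (\<forall>k. J k \<subseteq> ideal_gen {c * b | c l b. (l, b) \<in> B \<and> l \<le> k \<and> c \<in> ideal_pow {0} (k - l)})"
  proof (rule rees_finitely_generated[OF I[symmetric]])
    fix k
    show "is_ideal (J k)" using assms zero by (simp add: J_def)
    show "a * x \<in> J (Suc k)" if "a \<in> {0}" for a x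
      using that by (simp add: J_def)
    show "J k \<subseteq> ideal_pow {0} k"
      using is_idealD(1)[OF is_ideal_ideal_pow, of "{0} :: ('n, 'k) mpoly set" k] by (auto simp: J_def)
  qed
  then obtain B where B: "finite B" "\<forall>(k, b)\<in>B. b \<in> J k"
    "\<forall>k. J k \<subseteq> ideal_gen {c * b | c l b. (l, b) \<in> B \<and> l \<le> k \<and> c \<in> ideal_pow {0} (k - l)}"
    by blast
  let ?A = "{b. (0, b) \<in> B}"
  have "?A \<subseteq> snd ` B" by force
  then have fin: "finite ?A" using B(1) finite_subset by blast
  have "ideal_gen {c * b | c l b. (l, b) \<in> B \<and> l \<le> 0 \<and> c \<in> ideal_pow {0} (0 - l)} \<subseteq> ideal_gen ?A"
  proof (intro ideal_gen_least is_ideal_ideal_gen subsetI)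
    fix x assume "x \<in> {c * b | c l b. (l, b) \<in> B \<and> l \<le> 0 \<and> c \<in> ideal_pow {0} (0 - l)}"
    then obtain c b where x: "x = c * b" "(0, b) \<in> B" by auto
    then have "b \<in> ideal_gen ?A" by (intro subsetD[OF ideal_gen_superset]) auto
    then show "x \<in> ideal_gen ?A" unfolding x(1) by (rule is_idealD(3)[OF is_ideal_ideal_gen])
  qed
  then have "L \<subseteq> ideal_gen ?A"
    using B(3)[rule_format, of 0] by (simp add: J_def)
  moreover have "ideal_gen ?A \<subseteq> L"
    using B(2) assms by (intro ideal_gen_least) (auto simp: J_def)
  ultimately show ?thesis using fin by blast
qed

section \<open>Homogeneous generators, their degrees, and Artin-Rees for colon ideals\<close>

lemma graded_ideal_homog_generators:
  fixes L :: "('n::finite, 'k::field) mpoly set"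
  assumes L: "graded_ideal L"
  shows "\<exists>(s :: nat) e \<delta>. L = ideal_gen (e ` {..<s}) \<and> (\<forall>j<s. homog (\<delta> j) (e j))"
proof -
  obtain A where A: "finite A" "L = ideal_gen A"
    using hilbert_basis graded_idealD(1)[OF L] by blast
  let ?H = "(\<lambda>(a, d). hcomp d a) ` (SIGMA a:A. mdeg ` Poly_Mapping.keys a)"
  have "finite ?H" using A(1) by auto
  then obtain s and e :: "nat \<Rightarrow> ('n, 'k) mpoly" where e: "?H = e ` {i. i < s}"
    using finite_imp_nat_seg_image_inj_on by metis
  have "A \<subseteq> ideal_gen ?H"
  proof
    fix a assume "a \<in> A"
    then have "(\<Sum>d\<in>mdeg ` Poly_Mapping.keys a. hcomp d a) \<in> ideal_gen ?H"
      by (intro is_ideal_sum is_ideal_ideal_gen subsetD[OF ideal_gen_superset]) auto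
    then show "a \<in> ideal_gen ?H" by (simp add: sum_hcomp)
  qed
  then have "L \<subseteq> ideal_gen ?H" unfolding A(2) by (intro ideal_gen_least is_ideal_ideal_gen)
  moreover have "A \<subseteq> L" unfolding A(2) by (rule ideal_gen_superset)
  then have "ideal_gen ?H \<subseteq> L"
    by (intro ideal_gen_least graded_idealD(1)[OF L]) (auto intro: graded_idealD(2)[OF L])
  moreover have "\<exists>d. homog d (e j)" if "j < s" for j
  proof -
    have "e j \<in> ?H" unfolding e using that by auto
    then obtain a d where "e j = hcomp d a" by auto
    then show ?thesis using homog_hcomp by metis
  qed
  then obtain \<delta> where "\<And>j. j < s \<Longrightarrow> homog (\<delta> j) (e j)" by metis
  ultimately show ?thesis using e by (metis lessThan_def subset_antisym)
qed

text \<open>Makes the \<open>GREATEST\<close> in omega meaningful. Above all generator degrees of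
  \<open>J\<close>, components are built from variables times elements of \<open>J\<close> and so
  lie in \<open>mJ\<close>.\<close>

lemma bounded_minimal_generator_degrees:
  fixes J N :: "('n::finite, 'k::field) mpoly set"
  assumes J: "graded_ideal J" and N: "is_ideal N"
  shows "\<exists>M. \<forall>d f. homog d f \<and> f \<in> J \<and> f \<notin> ideal_sum N (ideal_prod max_ideal J) \<longrightarrow> d \<le> M"
proof -
  obtain s :: nat and e \<delta> where e: "J = ideal_gen (e ` {..<s})" "\<And>j. j < s \<Longrightarrow> homog (\<delta> j) (e j)"
    using graded_ideal_homog_generators[OF J] by blast
  define M where "M = Max (insert 0 (\<delta> ` {..<s}))"
  have M: "\<delta> j \<le> M" if "j < s" for j
    unfolding M_def using that by (intro Max_ge) auto
  have mJ: "is_ideal (ideal_prod max_ideal J)" by (rule is_ideal_ideal_prod)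
  let ?L = "{p \<in> J. \<forall>d>M. hcomp d p \<in> ideal_prod max_ideal J}"
  have "is_ideal ?L"
  proof (rule is_ideal_mpolyI)
    fix i p assume "p \<in> ?L"
    then show "var i * p \<in> ?L"
      using graded_idealD[OF J] is_idealD(3)[of J] var_mult_max_ideal[of _ J i] is_idealD(1)[OF mJ]
      by (auto simp: hcomp_var_mult)
  qed (use graded_idealD(1)[OF J] is_idealD(1-3)[of J] is_idealD(1-3)[OF mJ] in
      \<open>auto simp: hcomp_add hcomp_const_mult\<close>)
  moreover have "e ` {..<s} \<subseteq> ?L"
  proof clarify
    fix j assume j: "j < s"
    have "e j \<in> J" unfolding e(1) using j by (intro subsetD[OF ideal_gen_superset]) auto
    moreover have "hcomp d (e j) = 0" if "d > M" for d
      using hcomp_homog[OF e(2)[OF j], of d] M[OF j] that by auto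
    ultimately show "e j \<in> J \<and> (\<forall>d>M. hcomp d (e j) \<in> ideal_prod max_ideal J)"
      using is_idealD(1)[OF mJ] by auto
  qed
  ultimately have sub: "J \<subseteq> ?L" by (subst (1) e(1)) (rule ideal_gen_least)
  have "d \<le> M" if f: "homog d f" "f \<in> J" "f \<notin> ideal_sum N (ideal_prod max_ideal J)" for d f
  proof (rule ccontr)
    assume "\<not> d \<le> M"
    then have "hcomp d f \<in> ideal_prod max_ideal J" using sub f(2) by auto
    then show False
      using f(1,3) ideal_sum_upper(2)[OF N mJ] by (auto simp: hcomp_homog)
  qed
  then show ?thesis by blast
qed

text \<open>For \<open>J k = I^k \<inter> aS\<close>, stability from \<open>c\<close> on puts
  \<open>J (c + k)\<close> inside \<open>I^k * J c\<close>, hence inside \<open>a * I^k\<close>;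
  then \<open>a\<close> is cancelled, there being no zero divisors.\<close>

lemma artin_rees_principal:
  fixes f :: "nat \<Rightarrow> ('n::finite, 'k::field) mpoly"
  assumes I: "I = ideal_gen (f ` {..<r})" and "a \<noteq> 0"
  shows "\<exists>c. \<forall>k z. a * z \<in> ideal_pow I (c + k) \<longrightarrow> z \<in> ideal_pow I k"
proof -
  have multiples: "is_ideal {a * z | z. z \<in> L}" if "is_ideal L" for L
    unfolding is_ideal_def
  proof (intro conjI ballI allI)
    show "0 \<in> {a * z | z. z \<in> L}" using is_idealD(1)[OF that] by force
  next
    fix x y assume "x \<in> {a * z | z. z \<in> L}" "y \<in> {a * z | z. z \<in> L}"
    then obtain z t where "x = a * z" "y = a * t" "z \<in> L" "t \<in> L" by auto
    then have "x + y = a * (z + t)" "z + t \<in> L"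
      using is_idealD(2)[OF that] by (auto simp: distrib_left)
    then show "x + y \<in> {a * z | z. z \<in> L}" by blast
  next
    fix x q assume "x \<in> {a * z | z. z \<in> L}"
    then obtain z where "x = a * z" "z \<in> L" by auto
    then have "q * x = a * (q * z)" "q * z \<in> L"
      by (simp add: mult_ac) (rule is_idealD(3)[OF that \<open>z \<in> L\<close>])
    then show "q * x \<in> {a * z | z. z \<in> L}" by blast
  qed
  define J where "J k = ideal_pow I k \<inter> range ((*) a)" for k
  have "\<exists>c. \<forall>k\<ge>c. J (Suc k) \<subseteq> ideal_prod I (J k)"
  proof (rule rees_stable[OF I])
    fix k
    have "is_ideal (range ((*) a))" using multiples[OF is_ideal_UNIV] by (simp add: full_SetCompr_eq)
    then show "is_ideal (J k)"
      using is_ideal_ideal_pow[of I k] unfolding J_def by (auto simp: is_ideal_def)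
    show "b * x \<in> J (Suc k)" if "b \<in> I" "x \<in> J k" for b x
      using that by (auto simp: J_def intro: ideal_prodI mult.left_commute)
    show "J k \<subseteq> ideal_pow I k" by (simp add: J_def)
  qed
  then obtain c where c: "\<forall>k\<ge>c. J (Suc k) \<subseteq> ideal_prod I (J k)" by blast
  have J: "J (c + k) \<subseteq> {a * z | z. z \<in> ideal_pow I k}" for k
  proof (induction k)
    case 0
    then show ?case by (auto simp: J_def)
  next
    case (Suc k)
    have "ideal_prod I (J (c + k)) \<subseteq> {a * z | z. z \<in> ideal_pow I (Suc k)}"
    proof (intro ideal_prod_least multiples is_ideal_ideal_pow)
      fix b x assume b: "b \<in> I" and "x \<in> J (c + k)"
      then obtain z where "x = a * z" "z \<in> ideal_pow I k" using Suc by blast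
      then have "b * x = a * (b * z)" "b * z \<in> ideal_pow I (Suc k)"
        using b by (auto simp: mult_ac intro: ideal_prodI)
      then show "b * x \<in> {a * z | z. z \<in> ideal_pow I (Suc k)}" by blast
    qed
    moreover have "J (Suc (c + k)) \<subseteq> ideal_prod I (J (c + k))" using c by simp
    ultimately show ?case by simp
  qed
  have "z \<in> ideal_pow I k" if "a * z \<in> ideal_pow I (c + k)" for k z
  proof -
    have "a * z \<in> J (c + k)" using that by (simp add: J_def)
    then obtain t where t: "a * z = a * t" "t \<in> ideal_pow I k" using J by blast
    then have "a * (z - t) = 0" by (simp add: right_diff_distrib)
    then have "z = t" using mpoly_no_zero_divisors[OF assms(2), of "z - t"] by auto
    then show ?thesis using t by simp
  qed
  then show ?thesis by blast
qed

lemma colon_pow_mult: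
  assumes "a \<in> I" "x \<in> colon (ideal_pow I k) P"
  shows "a * x \<in> colon (ideal_pow I (Suc k)) P"
  using assms by (auto simp: colon_def mult.assoc intro: ideal_prodI)

lemma colon_pow_stable:
  fixes f :: "nat \<Rightarrow> ('n::finite, 'k::field) mpoly"
  assumes I: "I = ideal_gen (f ` {..<r})" and "I \<noteq> {0}" and "I \<subseteq> P"
  shows "\<exists>k0. \<forall>k\<ge>k0. colon (ideal_pow I (Suc k)) P \<subseteq> ideal_prod I (colon (ideal_pow I k) P)"
proof -
  have "0 \<in> I" unfolding I by (rule is_idealD(1)[OF is_ideal_ideal_gen])
  then obtain a where a: "a \<in> I" "a \<noteq> 0" using assms(2) by blast
  obtain c where c: "\<And>k z. a * z \<in> ideal_pow I (c + k) \<Longrightarrow> z \<in> ideal_pow I k"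
    using artin_rees_principal[OF I a(2)] by blast
  \<comment> \<open>A colon ideal need not lie in the power of the same index, so the family is
    shifted by the Artin-Rees constant \<open>c\<close> before \<open>rees_stable\<close>
    applies.\<close>
  have "\<exists>k0. \<forall>k\<ge>k0. colon (ideal_pow I (c + Suc k)) P \<subseteq> ideal_prod I (colon (ideal_pow I (c + k)) P)"
  proof (rule rees_stable[OF I])
    fix k
    show "is_ideal (colon (ideal_pow I (c + k)) P)" by (intro is_ideal_colon is_ideal_ideal_pow)
    show "b * x \<in> colon (ideal_pow I (c + Suc k)) P"
      if "b \<in> I" "x \<in> colon (ideal_pow I (c + k)) P" for b x
      using colon_pow_mult[OF that] by simp
    show "colon (ideal_pow I (c + k)) P \<subseteq> ideal_pow I k"
    proof
      fix x assume "x \<in> colon (ideal_pow I (c + k)) P"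
      then have "a * x \<in> ideal_pow I (c + k)" using a(1) assms(3) by (auto simp: colon_def mult.commute)
      then show "x \<in> ideal_pow I k" by (rule c)
    qed
  qed
  then obtain k0 where k0: "\<forall>k\<ge>k0. colon (ideal_pow I (c + Suc k)) P \<subseteq> ideal_prod I (colon (ideal_pow I (c + k)) P)"
    by blast
  have "colon (ideal_pow I (Suc k)) P \<subseteq> ideal_prod I (colon (ideal_pow I k) P)" if "k \<ge> c + k0" for k
    using k0[rule_format, of "k - c"] that by (simp add: Suc_diff_le)
  then show ?thesis by blast
qed

section \<open>Degrees of minimal generators and v-numbers\<close>

text \<open>Variables act as zero on \<open>Q k\<close> modulo \<open>H k\<close>, so the products
  of the \<open>f i\<close> with generators of \<open>Q 0\<close> span this quotient over K
  (\<open>Q_T\<close>). A homogeneous element outside \<open>H k\<close> then shares its degree with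
  a standard product, while each standard product is itself outside \<open>H k\<close>.\<close>

lemma minimal_generator_degrees:
  fixes f :: "nat \<Rightarrow> ('n::finite, 'k::field) mpoly"
  assumes I: "I = ideal_gen (f ` {..<r})" and f_homog: "\<And>i. i < r \<Longrightarrow> homog (d i) (f i)"
    and Q: "\<And>k. graded_ideal (Q k)" "\<And>k a x. a \<in> I \<Longrightarrow> x \<in> Q k \<Longrightarrow> a * x \<in> Q (Suc k)"
    and Q_stable: "\<And>k. Q (Suc k) \<subseteq> ideal_prod I (Q k)"
    and M: "\<And>k. graded_ideal (M k)" "\<And>k a x. a \<in> I \<Longrightarrow> x \<in> M k \<Longrightarrow> a * x \<in> M (Suc k)"
    and MQ: "\<And>k. M k \<subseteq> Q k"
  shows "\<exists>(s :: nat) \<delta> D. D \<subseteq> {..<s} \<times> mons r \<and>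
    (\<forall>j u v. u \<in> mons r \<longrightarrow> v \<in> mons r \<longrightarrow> (j, u + v) \<in> D \<longrightarrow> (j, u) \<in> D) \<and>
    (\<forall>k. {m. \<exists>p. homog m p \<and> p \<in> Q k \<and> p \<notin> ideal_sum (M k) (ideal_prod max_ideal (Q k))} =
      {(\<Sum>i<r. d i * Poly_Mapping.lookup u i) + \<delta> j |j u. (j, u) \<in> D \<and> (\<Sum>i<r. Poly_Mapping.lookup u i) = k})"
proof -
  define H where "H k = ideal_sum (M k) (ideal_prod max_ideal (Q k))" for k
  have mQ: "graded_ideal (ideal_prod max_ideal (Q k))" for k
    by (intro graded_ideal_ideal_prod graded_ideal_max_ideal Q(1))
  have H: "graded_ideal (H k)" for k
    unfolding H_def by (intro graded_ideal_ideal_sum M(1) mQ)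
  have HQ: "H k \<subseteq> Q k" for k
    unfolding H_def by (intro ideal_sum_least MQ ideal_prod_subset graded_idealD(1)[OF Q(1)])
  have var_H: "var i * x \<in> H k" if "x \<in> Q k" for i x k
    unfolding H_def
    using ideal_sum_upper(2)[OF graded_idealD(1)[OF M(1)] graded_idealD(1)[OF mQ]]
      var_mult_max_ideal[OF that] by blast
  have H_mult: "a * x \<in> H (Suc k)" if "a \<in> I" "x \<in> H k" for a x k
  proof -
    obtain y z where x: "x = y + z" "y \<in> M k" "z \<in> ideal_prod max_ideal (Q k)"
      using \<open>x \<in> H k\<close> by (auto simp: H_def ideal_sum_def)
    have "b * c \<in> {z. \<forall>t\<in>{a}. z * t \<in> ideal_prod max_ideal (Q (Suc k))}" if "b \<in> max_ideal" "c \<in> Q k" for b c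
    proof -
      have "b * (a * c) \<in> ideal_prod max_ideal (Q (Suc k))"
        using that Q(2)[OF \<open>a \<in> I\<close>] by (intro ideal_prodI)
      then show ?thesis by (simp add: mult_ac)
    qed
    then have "ideal_prod max_ideal (Q k) \<subseteq> {z. \<forall>t\<in>{a}. z * t \<in> ideal_prod max_ideal (Q (Suc k))}"
      by (intro ideal_prod_least is_ideal_conductor is_ideal_ideal_prod)
    then have "a * z \<in> ideal_prod max_ideal (Q (Suc k))" using x(3) by (auto simp: mult.commute)
    moreover have "a * y \<in> M (Suc k)" using M(2) that(1) x(2) by blast
    ultimately show ?thesis by (auto simp: H_def ideal_sum_def x(1) distrib_left)
  qed
  obtain s :: nat and e \<delta> where e: "Q 0 = ideal_gen (e ` {..<s})" "\<And>j. j < s \<Longrightarrow> homog (\<delta> j) (e j)"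
    using graded_ideal_homog_generators[OF Q(1)] by blast
  have e_Q: "e j \<in> Q 0" if "j < s" for j
    unfolding e(1) using that by (intro subsetD[OF ideal_gen_superset]) auto
  have f: "f i \<in> I" if "i < r" for i
    unfolding I using that by (intro subsetD[OF ideal_gen_superset]) auto
  interpret H: standard_monomials r s f "\<lambda>_. Suc 0" e H
    by unfold_locales (auto intro: subspace_is_ideal graded_idealD(1)[OF H] H_mult f)
  \<comment> \<open>Records that products stay inside \<open>Q\<close>; standardness is always meant
    relative to \<open>H\<close>.\<close>
  interpret Q: standard_monomials r s f "\<lambda>_. Suc 0" e Q
    by unfold_locales (auto intro: subspace_is_ideal graded_idealD(1)[OF Q(1)] Q(2) f)
  have grade: "H.grade u = (\<Sum>i<r. Poly_Mapping.lookup u i)" for u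
    by (simp add: H.grade_def)
  have emon_Q: "H.emon q \<in> Q k" if "q \<in> H.ind k" for q k
    using that Q.mon_mult_J[of "e (fst q)" 0 "snd q"] e_Q by (auto simp: H.emon_def H.ind_def)
  have emon_homog: "homog ((\<Sum>i<r. d i * Poly_Mapping.lookup u i) + \<delta> j) (H.emon (j, u))" if "j < s" for j u
    unfolding H.emon_def H.mon_def using f_homog e(2)[OF that] homog_prod[of "{..<r}" _ "\<lambda>i. f i ^ Poly_Mapping.lookup u i"]
    by (auto intro!: homog_mult homog_prod homog_power)
  \<comment> \<open>Although built as a K-span, \<open>T k\<close> is an ideal: it lies in
    \<open>Q k\<close>, which every variable sends into \<open>H k\<close>.\<close>
  define T where "T k = kv.span (H.emon ` H.ind k \<union> H k)" for k
  have H_T: "H k \<subseteq> T k" for k by (auto simp: T_def intro: kv.span_base)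
  have T_Q: "T k \<subseteq> Q k" for k
    unfolding T_def using HQ emon_Q
    by (intro kv.span_minimal subspace_is_ideal graded_idealD(1)[OF Q(1)]) auto
  have T_ideal: "is_ideal (T k)" for k
  proof (rule is_ideal_mpolyI)
    fix i x assume "x \<in> T k"
    then show "var i * x \<in> T k" using T_Q var_H H_T by blast
  qed (auto simp: T_def intro: kv.span_zero kv.span_add kv.span_scale)
  have f_T: "f i * x \<in> T (Suc k)" if "i < r" "x \<in> T k" for i x k
    using that(2) unfolding T_def
  proof (rule mult_kv_span)
    fix a assume "a \<in> H.emon ` H.ind k \<union> H k"
    then show "f i * a \<in> kv.span (H.emon ` H.ind (Suc k) \<union> H (Suc k))"
    proof
      assume "a \<in> H k"
      then show ?thesis using H_mult f[OF that(1)] by (intro kv.span_base) auto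
    next
      assume "a \<in> H.emon ` H.ind k"
      then obtain j u where a: "a = H.emon (j, u)" "(j, u) \<in> H.ind k" by auto
      let ?u = "u + Poly_Mapping.single i 1"
      have "f i * a = H.emon (j, ?u)"
        using H.mon_single[OF that(1)] by (simp add: a(1) H.emon_def H.mon_add mult_ac)
      moreover have "(j, ?u) \<in> H.ind (Suc k)"
        using a(2) that(1) H.grade_single[OF that(1)]
        by (auto simp: H.ind_def H.grade_add intro!: mons_add mons_single)
      ultimately show ?thesis by (auto intro: kv.span_base)
    qed
  qed simp
  have Q_T: "Q k \<subseteq> T k" for k
  proof (induction k)
    case 0
    have "e j \<in> T 0" if "j < s" for j
    proof -
      have "H.emon (j, 0) \<in> T 0"
        unfolding T_def using that by (intro kv.span_base) (auto simp: H.ind_def mons_zero)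
      then show ?thesis by (simp add: H.emon_def)
    qed
    then show ?case unfolding e(1) by (intro ideal_gen_least T_ideal) auto
  next
    case (Suc k)
    have "I \<subseteq> {a. \<forall>b\<in>T k. a * b \<in> T (Suc k)}"
      unfolding I using f_T by (intro ideal_gen_least is_ideal_conductor T_ideal) auto
    then have "ideal_prod I (Q k) \<subseteq> T (Suc k)"
      using Suc by (intro ideal_prod_least T_ideal) auto
    then show ?case using Q_stable by blast
  qed
  define D where "D = ({..<s} \<times> mons r) - H.nonstd"
  have down: "(j, u) \<in> D" if "u \<in> mons r" "v \<in> mons r" "(j, u + v) \<in> D" for j u v
    using that H.nonstd_add[of j u v] by (auto simp: D_def)
  have degrees: "{m. \<exists>p. homog m p \<and> p \<in> Q k \<and> p \<notin> H k} =
      {(\<Sum>i<r. d i * Poly_Mapping.lookup u i) + \<delta> j |j u. (j, u) \<in> D \<and> (\<Sum>i<r. Poly_Mapping.lookup u i) = k}" for k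
  proof (intro equalityI subsetI)
    fix m assume "m \<in> {(\<Sum>i<r. d i * Poly_Mapping.lookup u i) + \<delta> j |j u. (j, u) \<in> D \<and> (\<Sum>i<r. Poly_Mapping.lookup u i) = k}"
    then obtain j u where m: "m = (\<Sum>i<r. d i * Poly_Mapping.lookup u i) + \<delta> j" and ju: "(j, u) \<in> D" "H.grade u = k"
      by (auto simp: grade)
    have q: "(j, u) \<in> H.ind k" "(j, u) \<notin> H.nonstd" "j < s" using ju by (auto simp: D_def H.ind_def)
    have "homog m (H.emon (j, u))" unfolding m by (rule emon_homog[OF q(3)])
    then show "m \<in> {m. \<exists>p. homog m p \<and> p \<in> Q k \<and> p \<notin> H k}"
      using emon_Q[OF q(1)] H.emon_std_notin_J[OF q(1,2)] by blast
  next
    fix m assume "m \<in> {m. \<exists>p. homog m p \<and> p \<in> Q k \<and> p \<notin> H k}"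
    then obtain p where p: "homog m p" "p \<in> Q k" "p \<notin> H k" by blast
    have Hk: "is_ideal (H k)" by (rule graded_idealD(1)[OF H])
    have "p \<in> T k" using p(2) Q_T by blast
    then obtain y z where y: "y \<in> kv.span (H.emon ` H.ind k)" and z: "z \<in> kv.span (H k)" "p = y + z"
      unfolding T_def kv.span_Un by blast
    have "kv.span (H k) \<subseteq> H k" using Hk by (intro kv.span_minimal subspace_is_ideal) auto
    then have zH: "z \<in> H k" using z(1) by blast
    obtain y' z' where y': "y' \<in> kv.span (H.emon ` (H.ind k - H.nonstd))" "z' \<in> H k" "y = y' + z'"
      using H.span_std_reduction y by blast
    \<comment> \<open>Passing to degree \<open>m\<close> keeps \<open>p\<close> and keeps the
      correction inside the graded ideal \<open>H k\<close>, so the standard part \<open>y'\<close>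
      must have a nonzero component of degree \<open>m\<close>.\<close>
    have "p = y' + (z' + z)" using z(2) y'(3) by simp
    then have p_eq: "p = hcomp m y' + hcomp m (z' + z)"
      using hcomp_homog[OF p(1), of m] hcomp_add[of m y' "z' + z"] by simp
    moreover have "hcomp m (z' + z) \<in> H k"
      using zH y'(2) is_idealD(2)[OF Hk] graded_idealD(2)[OF H] by blast
    ultimately have "hcomp m y' \<noteq> 0" using p(3) by auto
    have "\<exists>q\<in>H.ind k - H.nonstd. hcomp m (H.emon q) \<noteq> 0"
    proof (rule ccontr)
      assume "\<not> ?thesis"
      then have "H.emon ` (H.ind k - H.nonstd) \<subseteq> {y. hcomp m y = 0}" by auto
      moreover have "kv.subspace {y. hcomp m y = 0}"
        by (auto simp: kv.subspace_def hcomp_add hcomp_const_mult)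
      ultimately have "kv.span (H.emon ` (H.ind k - H.nonstd)) \<subseteq> {y. hcomp m y = 0}"
        by (rule kv.span_minimal)
      then show False using y'(1) \<open>hcomp m y' \<noteq> 0\<close> by blast
    qed
    then obtain j u where ju: "(j, u) \<in> H.ind k" "(j, u) \<notin> H.nonstd" "hcomp m (H.emon (j, u)) \<noteq> 0"
      by auto
    then have "j < s" by (auto simp: H.ind_def)
    then have "m = (\<Sum>i<r. d i * Poly_Mapping.lookup u i) + \<delta> j"
      using ju(3) hcomp_homog[OF emon_homog[of j u], of m] by (auto split: if_splits)
    then show "m \<in> {(\<Sum>i<r. d i * Poly_Mapping.lookup u i) + \<delta> j |j u. (j, u) \<in> D \<and> (\<Sum>i<r. Poly_Mapping.lookup u i) = k}"
      using ju(1,2) by (auto simp: D_def H.ind_def grade)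
  qed
  have D: "D \<subseteq> {..<s} \<times> mons r" by (auto simp: D_def)
  show ?thesis
    unfolding H_def[symmetric]
    by (intro exI[of _ s] exI[of _ \<delta>] exI[of _ D] conjI allI impI) (fact D, fact down, fact degrees)
qed

lemma ev_linear_max_nonempty:
  assumes "ev_linear_max E" "\<And>k. E k \<noteq> {}"
  shows "\<exists>a b k0. \<forall>k\<ge>k0. a * int k + b \<in> E k \<and> (\<forall>e\<in>E k. e \<le> a * int k + b)"
  using assms unfolding ev_linear_max_def by blast

lemma ev_linear_degrees:
  fixes E :: "nat \<Rightarrow> nat set" and D :: "(nat \<times> (nat \<Rightarrow>\<^sub>0 nat)) set"
  assumes D: "D \<subseteq> {..<s} \<times> mons r"
    "\<And>j u v. u \<in> mons r \<Longrightarrow> v \<in> mons r \<Longrightarrow> (j, u + v) \<in> D \<Longrightarrow> (j, u) \<in> D"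
    and E: "\<And>k. E k = {(\<Sum>i<r. d i * Poly_Mapping.lookup u i) + \<delta> j |j u.
      (j, u) \<in> D \<and> (\<Sum>i<r. Poly_Mapping.lookup u i) = k}" "\<And>k. E k \<noteq> {}"
  shows "\<exists>(a::int) b k0. \<forall>k\<ge>k0. \<exists>m\<in>E k. int m = a * int k + b \<and> (\<forall>e\<in>E k. e \<le> m)"
    and "\<exists>(a::int) b k0. \<forall>k\<ge>k0. \<exists>m\<in>E k. int m = a * int k + b \<and> (\<forall>e\<in>E k. m \<le> e)"
proof -
  \<comment> \<open>The sign \<open>\<sigma>\<close> is 1 for the maximum and -1 for the minimum; in
    the second case the linear function is negated back afterwards.\<close>
  have max: "\<exists>a b k0. \<forall>k\<ge>k0. a * int k + b \<in> (\<lambda>m. \<sigma> * int m) ` E k \<and>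
      (\<forall>e\<in>(\<lambda>m. \<sigma> * int m) ` E k. e \<le> a * int k + b)" for \<sigma> :: int
  proof (rule ev_linear_max_nonempty)
    have "ev_linear_max (\<lambda>k. {(\<Sum>i<r. (\<sigma> * int (d i)) * int (Poly_Mapping.lookup u i)) + \<sigma> * int (\<delta> j) |j u.
      (j, u) \<in> D \<and> (\<Sum>i<r. Poly_Mapping.lookup u i) = k})"
      by (rule ev_linear_max_downset[OF D])
    also have "(\<lambda>k. {(\<Sum>i<r. (\<sigma> * int (d i)) * int (Poly_Mapping.lookup u i)) + \<sigma> * int (\<delta> j) |j u.
      (j, u) \<in> D \<and> (\<Sum>i<r. Poly_Mapping.lookup u i) = k}) = (\<lambda>k. (\<lambda>m. \<sigma> * int m) ` E k)"
    proof
      fix k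
      have *: "(\<Sum>i<r. (\<sigma> * int (d i)) * int (Poly_Mapping.lookup u i)) + \<sigma> * int (\<delta> j) =
          \<sigma> * int ((\<Sum>i<r. d i * Poly_Mapping.lookup u i) + \<delta> j)" for j u
        by (simp add: distrib_left sum_distrib_left mult.assoc)
      show "{(\<Sum>i<r. (\<sigma> * int (d i)) * int (Poly_Mapping.lookup u i)) + \<sigma> * int (\<delta> j) |j u.
        (j, u) \<in> D \<and> (\<Sum>i<r. Poly_Mapping.lookup u i) = k} = (\<lambda>m. \<sigma> * int m) ` E k"
        unfolding E * by blast
    qed
    finally show "ev_linear_max (\<lambda>k. (\<lambda>m. \<sigma> * int m) ` E k)" .
  qed (use E(2) in auto)
  obtain a b k0 where k0: "\<And>k. k \<ge> k0 \<Longrightarrow> a * int k + b \<in> (\<lambda>m. 1 * int m) ` E k \<and>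
      (\<forall>e\<in>(\<lambda>m. 1 * int m) ` E k. e \<le> a * int k + b)"
    using max[of 1] by blast
  have "\<exists>m\<in>E k. int m = a * int k + b \<and> (\<forall>e\<in>E k. e \<le> m)" if k: "k \<ge> k0" for k
  proof -
    obtain m where m: "m \<in> E k" "int m = a * int k + b" using k0[OF k] by auto
    then have "\<forall>e\<in>E k. int e \<le> int m" using k0[OF k] by auto
    then have "\<forall>e\<in>E k. e \<le> m" by simp
    then show ?thesis using m by blast
  qed
  then show "\<exists>(a::int) b k0. \<forall>k\<ge>k0. \<exists>m\<in>E k. int m = a * int k + b \<and> (\<forall>e\<in>E k. e \<le> m)" by blast
  obtain a b k0 where k0: "\<And>k. k \<ge> k0 \<Longrightarrow> a * int k + b \<in> (\<lambda>m. - 1 * int m) ` E k \<and>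
      (\<forall>e\<in>(\<lambda>m. - 1 * int m) ` E k. e \<le> a * int k + b)"
    using max[of "- 1"] by blast
  have "\<exists>m\<in>E k. int m = - a * int k + - b \<and> (\<forall>e\<in>E k. m \<le> e)" if k: "k \<ge> k0" for k
  proof -
    obtain m where m: "m \<in> E k" "- int m = a * int k + b" using k0[OF k] by auto
    then have "\<forall>e\<in>E k. - int e \<le> - int m" using k0[OF k] by auto
    then have "\<forall>e\<in>E k. m \<le> e" by simp
    moreover have "int m = - a * int k + - b" using m(2) by simp
    ultimately show ?thesis using m(1) by blast
  qed
  then show "\<exists>(a::int) b k0. \<forall>k\<ge>k0. \<exists>m\<in>E k. int m = a * int k + b \<and> (\<forall>e\<in>E k. m \<le> e)" by blast
qed

section \<open>Alpha and omega as extreme degrees of minimal generators\<close>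

lemma omega_quot_eq:
  assumes "m \<in> {d. \<exists>f. homog d f \<and> f \<in> J \<and> f \<notin> ideal_sum N (ideal_prod max_ideal J)}"
    and "\<forall>e\<in>{d. \<exists>f. homog d f \<and> f \<in> J \<and> f \<notin> ideal_sum N (ideal_prod max_ideal J)}. e \<le> m"
  shows "omega_quot J N = m"
  unfolding omega_quot_def by (rule Greatest_equality) (use assms in auto)

text \<open>Alpha concerns elements outside \<open>N\<close>, the degree set elements outside
  \<open>N + mJ\<close>. By Nakayama, without a minimal generator in degree at most \<open>y\<close>
  every element of \<open>J\<close> of degree \<open>y\<close> would lie in
  \<open>N\<close>.\<close>

lemma alpha_quot_eq:
  fixes J N :: "('n::finite, 'k::field) mpoly set"
  assumes N: "graded_ideal N" and J: "graded_ideal J"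
    and m: "m \<in> {d. \<exists>f. homog d f \<and> f \<in> J \<and> f \<notin> ideal_sum N (ideal_prod max_ideal J)}"
    and min: "\<forall>e\<in>{d. \<exists>f. homog d f \<and> f \<in> J \<and> f \<notin> ideal_sum N (ideal_prod max_ideal J)}. m \<le> e"
  shows "alpha_quot J N = m"
  unfolding alpha_quot_def
proof (rule Least_equality)
  show "\<exists>f. homog m f \<and> f \<in> J \<and> f \<notin> N"
    using m ideal_sum_upper(1)[OF graded_idealD(1)[OF N] is_ideal_ideal_prod] by blast
next
  fix y assume "\<exists>f. homog y f \<and> f \<in> J \<and> f \<notin> N"
  then obtain f where f: "homog y f" "f \<in> J" "f \<notin> N" by blast
  let ?G = "{g. \<exists>e\<le>y. homog e g \<and> g \<in> J \<and> g \<notin> ideal_sum N (ideal_prod max_ideal J)}"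
  have "?G \<noteq> {}"
  proof
    assume empty: "?G = {}"
    have "f \<in> ideal_gen (N \<union> ?G)"
      by (rule graded_nakayama[OF N J f(1,2)])
    also have "ideal_gen (N \<union> ?G) \<subseteq> N"
      unfolding empty by (rule ideal_gen_least[OF graded_idealD(1)[OF N]]) simp
    finally show False using f(3) by simp
  qed
  then obtain e where "e \<le> y" "e \<in> {d. \<exists>f. homog d f \<and> f \<in> J \<and> f \<notin> ideal_sum N (ideal_prod max_ideal J)}" by blast
  then show "m \<le> y" using min by auto
qed

lemma exists_minimal_generator:
  fixes J N :: "('n::finite, 'k::field) mpoly set"
  assumes N: "graded_ideal N" and J: "graded_ideal J" and "\<not> J \<subseteq> N"
  shows "{d. \<exists>f. homog d f \<and> f \<in> J \<and> f \<notin> ideal_sum N (ideal_prod max_ideal J)} \<noteq> {}"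
proof
  assume empty: "{d. \<exists>f. homog d f \<and> f \<in> J \<and> f \<notin> ideal_sum N (ideal_prod max_ideal J)} = {}"
  obtain f where f: "f \<in> J" "f \<notin> N" using assms(3) by blast
  have "hcomp d f \<in> N" for d
  proof -
    have "hcomp d f \<in> ideal_gen (N \<union> {g. \<exists>e\<le>d. homog e g \<and> g \<in> J \<and> g \<notin> ideal_sum N (ideal_prod max_ideal J)})"
      by (intro graded_nakayama N J homog_hcomp graded_idealD(2)[OF J] f)
    also have "\<dots> \<subseteq> N"
      using empty by (intro ideal_gen_least graded_idealD(1)[OF N]) blast
    finally show ?thesis .
  qed
  then have "(\<Sum>d\<in>mdeg ` Poly_Mapping.keys f. hcomp d f) \<in> N"
    by (intro is_ideal_sum graded_idealD(1)[OF N])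
  then show False using f(2) by (simp add: sum_hcomp)
qed

section \<open>Homogeneous witnesses and bounds for v-numbers\<close>

lemma Ass_witness_in_colon: "colon_elem N f = P \<Longrightarrow> f \<in> colon N P"
  by (auto simp: colon_def colon_elem_def mult.commute)

lemma Ass_witness_notin:
  assumes "is_ideal N" "P \<in> Ass N" "colon_elem N f = P"
  shows "f \<notin> N"
proof
  assume "f \<in> N"
  then have "P = UNIV" using is_idealD(3)[OF assms(1)] assms(3) by (auto simp: colon_elem_def)
  then show False using assms(2) by (auto simp: Ass_def prime_ideal_def)
qed

lemma v_number_at_witness:
  fixes N P :: "('n::finite, 'k::field) mpoly set"
  assumes "graded_ideal N" "P \<in> Ass N"
  shows "\<exists>f. homog (v_number_at N P) f \<and> colon_elem N f = P"
  unfolding v_number_at_def by (rule LeastI_ex) (rule Ass_homog_witness[OF assms])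

lemma alpha_quot_le_v_number_at:
  fixes N P :: "('n::finite, 'k::field) mpoly set"
  assumes N: "graded_ideal N" and P: "P \<in> Ass N"
  shows "alpha_quot (colon N P) N \<le> v_number_at N P"
proof -
  obtain f where f: "homog (v_number_at N P) f" "colon_elem N f = P"
    using v_number_at_witness[OF assms] by blast
  then show ?thesis
    unfolding alpha_quot_def
    using Ass_witness_in_colon Ass_witness_notin[OF graded_idealD(1)[OF N] P] by (intro Least_le) blast
qed

text \<open>The minimal generator \<open>h\<close> that witnesses \<open>P\<close> has a degree
  \<open>e\<close> which is at least the v-number, being the degree of a witness, and at most omega,
  generator degrees being bounded. The witness \<open>g\<close> to start from may have any
  degree.\<close>

lemma v_number_at_le_omega_quot:
  fixes N P :: "('n::finite, 'k::field) mpoly set"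
  assumes N: "graded_ideal N" and P: "P \<in> Ass N"
  shows "v_number_at N P \<le> omega_quot (colon N P) N"
proof -
  let ?J = "colon N P"
  have J: "graded_ideal ?J" by (rule graded_ideal_colon[OF N graded_ideal_Ass[OF N P]])
  have prime: "prime_ideal P" using P by (simp add: Ass_def)
  obtain d g where g: "homog d g" "colon_elem N g = P" using Ass_homog_witness[OF N P] by blast
  let ?G = "{h. \<exists>e\<le>d. homog e h \<and> h \<in> ?J \<and> h \<notin> ideal_sum N (ideal_prod max_ideal ?J)}"
  have "g \<in> ideal_gen (N \<union> ?G)"
    by (rule graded_nakayama[OF N J g(1) Ass_witness_in_colon[OF g(2)]])
  then obtain h where h: "h \<in> ?G" "colon_elem N h \<subseteq> P"
    using prime_ideal_inter_colon_elem[OF prime graded_idealD(1)[OF N]] g(2) by blast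
  then obtain e where e: "homog e h" "h \<in> ?J" "h \<notin> ideal_sum N (ideal_prod max_ideal ?J)" by blast
  have "P \<subseteq> colon_elem N h" using e(2) by (auto simp: colon_def colon_elem_def mult.commute)
  then have "colon_elem N h = P" using h(2) by blast
  then have "v_number_at N P \<le> e"
    unfolding v_number_at_def using e(1) by (intro Least_le) blast
  also have "e \<le> omega_quot ?J N"
  proof -
    obtain M where "\<forall>d f. homog d f \<and> f \<in> ?J \<and> f \<notin> ideal_sum N (ideal_prod max_ideal ?J) \<longrightarrow> d \<le> M"
      using bounded_minimal_generator_degrees[OF J graded_idealD(1)[OF N]] by blast
    then show ?thesis unfolding omega_quot_def using e by (intro Greatest_le_nat[of _ e M]) blast+
  qed
  finally show ?thesis .
qed

lemma v_number_le_v_number_at: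
  fixes N P :: "('n::finite, 'k::field) mpoly set"
  assumes "graded_ideal N" "P \<in> Ass N"
  shows "v_number N \<le> v_number_at N P"
  unfolding v_number_def using v_number_at_witness[OF assms] assms(2) by (intro Least_le) auto

lemma alpha_omega_ev_linear:
  fixes I P :: "('n::finite, 'k::field) mpoly set"
  assumes I: "graded_ideal I" and nonzero: "I \<noteq> {0}" and stable: "P \<in> Ass_inf I"
  shows "\<exists>a b :: int. \<exists>k0. \<forall>k\<ge>k0. int (alpha_quot (colon (ideal_pow I k) P) (ideal_pow I k)) = a * int k + b"
    and "\<exists>a b :: int. \<exists>k0. \<forall>k\<ge>k0. int (omega_quot (colon (ideal_pow I k) P) (ideal_pow I k)) = a * int k + b"
proof -
  obtain k1 where k1: "\<And>k. k \<ge> k1 \<Longrightarrow> P \<in> Ass (ideal_pow I k)"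
    using stable by (auto simp: Ass_inf_def)
  have pow: "graded_ideal (ideal_pow I k)" for k by (rule graded_ideal_ideal_pow[OF I])
  have P_graded: "graded_ideal P" using graded_ideal_Ass[OF pow k1] by blast
  have colon: "graded_ideal (colon (ideal_pow I k) P)" for k
    by (rule graded_ideal_colon[OF pow P_graded])
  \<comment> \<open>For \<open>a\<close> in \<open>I\<close> the power \<open>a ^ k1\<close> sends
    every element, hence the witness, into \<open>I^k1\<close>, so it lies in the prime
    \<open>P\<close>.\<close>
  have I_P: "I \<subseteq> P"
  proof
    fix a assume a: "a \<in> I"
    have P: "P \<in> Ass (ideal_pow I k1)" by (rule k1) simp
    then obtain f where "colon_elem (ideal_pow I k1) f = P" "prime_ideal P" by (auto simp: Ass_def)
    moreover have "a ^ k1 * f \<in> ideal_pow I k1"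
      by (intro is_idealD(4)[OF is_ideal_ideal_pow] power_mem_ideal_pow a)
    ultimately show "a \<in> P" using prime_ideal_power[of P a k1] by (auto simp: colon_elem_def)
  qed
  obtain r :: nat and f d where f: "I = ideal_gen (f ` {..<r})" "\<And>i. i < r \<Longrightarrow> homog (d i) (f i)"
    using graded_ideal_homog_generators[OF I] by blast
  obtain k2 where k2: "\<And>k. k \<ge> k2 \<Longrightarrow> colon (ideal_pow I (Suc k)) P \<subseteq> ideal_prod I (colon (ideal_pow I k) P)"
    using colon_pow_stable[OF f(1) nonzero I_P] by blast
  \<comment> \<open>From \<open>k1\<close> on the quotient is nonzero, from \<open>k2\<close> on the
    colon ideals are stable. Counting from \<open>K\<close> makes both hold at every index of the
    shifted families.\<close>
  define K where "K = max k1 k2"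
  define Q M where "Q k = colon (ideal_pow I (K + k)) P" and "M k = ideal_pow I (K + k)" for k
  define E where "E k = {m. \<exists>p. homog m p \<and> p \<in> Q k \<and> p \<notin> ideal_sum (M k) (ideal_prod max_ideal (Q k))}" for k
  have QM: "graded_ideal (Q k)" "graded_ideal (M k)" for k
    unfolding Q_def M_def by (rule colon pow)+
  have "\<exists>(s :: nat) \<delta> D. D \<subseteq> {..<s} \<times> mons r \<and>
    (\<forall>j u v. u \<in> mons r \<longrightarrow> v \<in> mons r \<longrightarrow> (j, u + v) \<in> D \<longrightarrow> (j, u) \<in> D) \<and>
    (\<forall>k. E k = {(\<Sum>i<r. d i * Poly_Mapping.lookup u i) + \<delta> j |j u. (j, u) \<in> D \<and> (\<Sum>i<r. Poly_Mapping.lookup u i) = k})"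
    unfolding E_def
  proof (rule minimal_generator_degrees[OF f QM(1) _ _ QM(2)])
    fix k
    show "a * x \<in> Q (Suc k)" if "a \<in> I" "x \<in> Q k" for a x
      using colon_pow_mult[OF that[unfolded Q_def]] by (simp add: Q_def)
    show "Q (Suc k) \<subseteq> ideal_prod I (Q k)"
      using k2[of "K + k"] by (simp add: Q_def K_def)
    show "a * x \<in> M (Suc k)" if "a \<in> I" "x \<in> M k" for a x
      using that by (simp add: M_def ideal_prodI)
    show "M k \<subseteq> Q k" unfolding M_def Q_def by (rule subset_colon[OF is_ideal_ideal_pow])
  qed
  then obtain s :: nat and \<delta> D where "D \<subseteq> {..<s} \<times> mons r \<and>
    (\<forall>j u v. u \<in> mons r \<longrightarrow> v \<in> mons r \<longrightarrow> (j, u + v) \<in> D \<longrightarrow> (j, u) \<in> D) \<and>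
    (\<forall>k. E k = {(\<Sum>i<r. d i * Poly_Mapping.lookup u i) + \<delta> j |j u. (j, u) \<in> D \<and> (\<Sum>i<r. Poly_Mapping.lookup u i) = k})"
    by (elim exE)
  then have D: "D \<subseteq> {..<s} \<times> mons r"
    "\<And>j u v. u \<in> mons r \<Longrightarrow> v \<in> mons r \<Longrightarrow> (j, u + v) \<in> D \<Longrightarrow> (j, u) \<in> D"
    "\<And>k. E k = {(\<Sum>i<r. d i * Poly_Mapping.lookup u i) + \<delta> j |j u. (j, u) \<in> D \<and> (\<Sum>i<r. Poly_Mapping.lookup u i) = k}"
    by simp_all
  have nonempty: "E k \<noteq> {}" for k
    unfolding E_def
  proof (rule exists_minimal_generator[OF QM(2,1)])
    have P: "P \<in> Ass (M k)" unfolding M_def by (rule k1) (simp add: K_def)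
    then obtain f where "colon_elem (M k) f = P" by (auto simp: Ass_def)
    then have "f \<in> Q k" "f \<notin> M k"
      using Ass_witness_in_colon[of "M k" f P] Ass_witness_notin[OF graded_idealD(1)[OF QM(2)] P]
      by (auto simp: Q_def M_def)
    then show "\<not> Q k \<subseteq> M k" by blast
  qed
  \<comment> \<open>Undoing the shift by \<open>K\<close> keeps the slope and changes the intercept
    to \<open>b - a * K\<close>.\<close>
  have shift: "\<exists>a b :: int. \<exists>k0. \<forall>k\<ge>k0. int (h k) = a * int k + b"
    if "\<forall>k\<ge>k0. int (h (K + k)) = a * int k + b" for h :: "nat \<Rightarrow> nat" and a b k0
  proof (intro exI allI impI)
    fix k assume "K + k0 \<le> k"
    then show "int (h k) = a * int k + (b - a * int K)"
      using that[rule_format, of "k - K"] by (simp add: of_nat_diff algebra_simps)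
  qed
  have "\<exists>(a::int) b k0. \<forall>k\<ge>k0. \<exists>m\<in>E k. int m = a * int k + b \<and> (\<forall>e\<in>E k. m \<le> e)"
    by (rule ev_linear_degrees(2)[OF D(1) _ D(3) nonempty]) (rule D(2))
  then obtain a b k0 where alpha: "\<forall>k\<ge>k0. \<exists>m\<in>E k. int m = a * int k + b \<and> (\<forall>e\<in>E k. m \<le> e)"
    by blast
  have "int (alpha_quot (Q k) (M k)) = a * int k + b" if "k \<ge> k0" for k
  proof -
    obtain m where m: "m \<in> E k" "int m = a * int k + b" "\<forall>e\<in>E k. m \<le> e"
      using alpha \<open>k \<ge> k0\<close> by blast
    show ?thesis
      using alpha_quot_eq[OF QM(2) QM(1) m(1)[unfolded E_def] m(3)[unfolded E_def]] m(2) by simp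
  qed
  then have "\<forall>k\<ge>k0. int (alpha_quot (Q k) (M k)) = a * int k + b" by blast
  then show "\<exists>a b :: int. \<exists>k0. \<forall>k\<ge>k0. int (alpha_quot (colon (ideal_pow I k) P) (ideal_pow I k)) = a * int k + b"
    unfolding Q_def M_def by (rule shift)
  have "\<exists>(a::int) b k0. \<forall>k\<ge>k0. \<exists>m\<in>E k. int m = a * int k + b \<and> (\<forall>e\<in>E k. e \<le> m)"
    by (rule ev_linear_degrees(1)[OF D(1) _ D(3) nonempty]) (rule D(2))
  then obtain a b k0 where omega: "\<forall>k\<ge>k0. \<exists>m\<in>E k. int m = a * int k + b \<and> (\<forall>e\<in>E k. e \<le> m)"
    by blast
  have "int (omega_quot (Q k) (M k)) = a * int k + b" if "k \<ge> k0" for k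
  proof -
    obtain m where m: "m \<in> E k" "int m = a * int k + b" "\<forall>e\<in>E k. e \<le> m"
      using omega \<open>k \<ge> k0\<close> by blast
    show ?thesis
      using omega_quot_eq[OF m(1)[unfolded E_def] m(3)[unfolded E_def]] m(2) by simp
  qed
  then have "\<forall>k\<ge>k0. int (omega_quot (Q k) (M k)) = a * int k + b" by blast
  then show "\<exists>a b :: int. \<exists>k0. \<forall>k\<ge>k0. int (omega_quot (colon (ideal_pow I k) P) (ideal_pow I k)) = a * int k + b"
    unfolding Q_def M_def by (rule shift)
qed

theorem theorem2p1:
  fixes I P :: "('n::finite, 'k::field) mpoly set"
  assumes graded: "graded_ideal I"
    and nonzero: "I \<noteq> {0}"
    and proper: "I \<noteq> UNIV"
    and stable: "P \<in> Ass_inf I"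
  shows
    "(\<forall>k\<ge>1. P \<in> Ass (ideal_pow I k) \<longrightarrow>
        alpha_quot (colon (ideal_pow I k) P) (ideal_pow I k) \<le> v_number_at (ideal_pow I k) P \<and>
        v_number_at (ideal_pow I k) P \<le> omega_quot (colon (ideal_pow I k) P) (ideal_pow I k))
     \<and> (\<exists>a b :: int. \<exists>k0. \<forall>k\<ge>k0.
          int (alpha_quot (colon (ideal_pow I k) P) (ideal_pow I k)) = a * int k + b)
     \<and> (\<exists>a b :: int. \<exists>k0. \<forall>k\<ge>k0.
          int (omega_quot (colon (ideal_pow I k) P) (ideal_pow I k)) = a * int k + b)
     \<and> (\<exists>f g :: nat \<Rightarrow> int.
          (\<exists>a b :: int. \<exists>k0. \<forall>k\<ge>k0. f k = a * int k + b) \<and>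
          (\<exists>a b :: int. \<exists>k0. \<forall>k\<ge>k0. g k = a * int k + b) \<and>
          (\<exists>k0. \<forall>k\<ge>k0. f k \<le> int (v_number (ideal_pow I k)) \<and>
                         int (v_number (ideal_pow I k)) \<le> g k))"
proof (intro conjI)
  have pow: "graded_ideal (ideal_pow I k)" for k by (rule graded_ideal_ideal_pow[OF graded])
  show "\<forall>k\<ge>1. P \<in> Ass (ideal_pow I k) \<longrightarrow>
        alpha_quot (colon (ideal_pow I k) P) (ideal_pow I k) \<le> v_number_at (ideal_pow I k) P \<and>
        v_number_at (ideal_pow I k) P \<le> omega_quot (colon (ideal_pow I k) P) (ideal_pow I k)"
    using alpha_quot_le_v_number_at[OF pow] v_number_at_le_omega_quot[OF pow] by blast
  show "\<exists>a b :: int. \<exists>k0. \<forall>k\<ge>k0.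
          int (alpha_quot (colon (ideal_pow I k) P) (ideal_pow I k)) = a * int k + b"
    by (rule alpha_omega_ev_linear(1)[OF graded nonzero stable])
  show omega: "\<exists>a b :: int. \<exists>k0. \<forall>k\<ge>k0.
          int (omega_quot (colon (ideal_pow I k) P) (ideal_pow I k)) = a * int k + b"
    by (rule alpha_omega_ev_linear(2)[OF graded nonzero stable])
  let ?g = "\<lambda>k. int (omega_quot (colon (ideal_pow I k) P) (ideal_pow I k))"
  obtain k0 where k0: "\<And>k. k \<ge> k0 \<Longrightarrow> P \<in> Ass (ideal_pow I k)"
    using stable by (auto simp: Ass_inf_def)
  \<comment> \<open>One stable prime is enough for the upper bound: the v-number is a minimum over
    all associated primes, among them \<open>P\<close>.\<close>
  have upper: "int (v_number (ideal_pow I k)) \<le> ?g k" if "k \<ge> k0" for k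
    using v_number_le_v_number_at[OF pow k0[OF that]] v_number_at_le_omega_quot[OF pow k0[OF that]] by simp
  show "\<exists>f g :: nat \<Rightarrow> int.
          (\<exists>a b :: int. \<exists>k0. \<forall>k\<ge>k0. f k = a * int k + b) \<and>
          (\<exists>a b :: int. \<exists>k0. \<forall>k\<ge>k0. g k = a * int k + b) \<and>
          (\<exists>k0. \<forall>k\<ge>k0. f k \<le> int (v_number (ideal_pow I k)) \<and>
                         int (v_number (ideal_pow I k)) \<le> g k)"
  proof (rule exI[of _ "\<lambda>_. 0"], rule exI[of _ ?g], intro conjI omega)
    show "\<exists>a b :: int. \<exists>k0 :: nat. \<forall>k\<ge>k0. 0 = a * int k + b"
      by (intro exI[of _ 0]) auto
    show "\<exists>k0. \<forall>k\<ge>k0. 0 \<le> int (v_number (ideal_pow I k)) \<and> int (v_number (ideal_pow I k)) \<le> ?g k"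
      using upper by (intro exI[of _ k0]) simp
  qed
qed

end
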